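(* Let $\Delta=(w,\lambda)$ be a simplicial multi-fan in $V$ on $[m]$. The following are equivalent: (1) the image of the index map $\pi_!^\Delta$ lies in $\mathbb R[V^*]\subset S^{-1}\mathbb R[V^*]$; (2) the underlying chain $w_{ch}=\sum_{I}w(I)I$ is closed (a cycle); (3) $\Delta$ is complete.
   Context: Let $V$ be an oriented real vector space of dimension $n\ge1$ with an inner product (identify $V^*=V$). A simplicial multi-fan $\Delta=(w,\lambda)$ on $[m]$ is a function $w\colon\binom{[m]}n\to\mathbb R$ and a map $\lambda\colon[m]\to V$ such that $\{\lambda(i)\}_{i\in I}$ is a basis of $V$ whenever $w(I)\ne0$. $K$ is the simplicial complex of all subsets of the $I$ with $w(I)\ne0$. Orient each such $I$ by declaring $(i_1,\dots,i_n)$ positive iff $(\lambda(i_1),\dots,\lambda(i_n))$ is a positive basis; $w_{ch}=\sum_Iw(I)I$ is a real simplicial chain of the $(n-1)$-skeleton of the simplex on $[m]$; "closed" means its boundary vanishes (for $n=1$ the boundary is the augmentation). Index map: grade $\mathbb R[x_1,\dots,x_m]$ and $\mathbb R[V^*]$ with generators of degree $2$; $S^{-1}\mathbb R[V^*]$ is the field of rational functions. For $w(I)\ne0$ let $\{u^I_i\}$ be the basis of $V^*$ dual to $\{\lambda(i)\}_{i\in I}$, $\iota_I\colon\mathbb R[x_1,\dots,x_m]\to\mathbb R[V^*]$ the algebra homomorphism with $\iota_I(x_i)=u^I_i$ for $i\in I$ and $0$ otherwise, and $|\det\lambda_I|$ the volume of the parallelepiped on $\{\lambda(i)\}_{i\in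 I}$. Then $\pi_!^\Delta(x)=\sum_{I:w(I)\ne0}\frac{w(I)\iota_I(x)}{|\det\lambda_I|\prod_{i\in I}\iota_I(x_i)}$. Completeness: for $J\in K$ with $|J|=k$, the projected multi-fan $\Delta_J$ lives in $V_J=V/\mathrm{span}\{\lambda(j)\}_{j\in J}$ (of dimension $n-k$), has vertex set $[m]\setminus J$, characteristic function $\lambda_J(i)=$ image of $\lambda(i)$ in $V_J$, and weights $w_J(J')=w(J\cup J')$ for $J'\subset[m]\setminus J$ with $|J'|=n-k$. For a multi-fan $(w',\lambda')$ in a space $W$ of dimension $d$, a vector $v\in W$ is generic if it lies in no span of fewer than $d$ vectors $\lambda'(i)$ with indices forming a face of a set of nonzero weight, and $d_v=\sum w'(I)$ over all $d$-sets $I$ with $w'(I)\ne0$ whose cone $\{\sum_{i\in I}r_i\lambda'(i): r_i\ge0\}$ contains $v$. The multi-fan is pre-complete if $d_v$ is independent of generic $v$ (a $0$-dimensional multi-fan is pre-complete). $\Delta$ is complete if $\Delta_J$ is pre-complete for every $J\in K$ (including $J=\varnothing$, $\Delta_\varnothing=\Delta$). *)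

theory Defs
  imports
    "HOL-Analysis.Analysis"
    "HOL-Library.Poly_Mapping"
    "HOL-Computational_Algebra.Fraction_Field"
    "Jordan_Normal_Form.Determinant"
begin

section \<open>The rings \<open>\<real>[V\<^sup>*]\<close> and \<open>\<real>[x\<^sub>1, \<dots>, x\<^sub>m]\<close>\<close>

text \<open>
  \<open>\<real>[V\<^sup>*]\<close>, the symmetric algebra of \<open>V\<^sup>*\<close>, is realised as the algebra of polynomial functions on
  \<open>V\<close>. This is harmless because \<open>\<real>\<close> is infinite. Its field of fractions
  \<open>S\<^sup>-\<^sup>1\<real>[V\<^sup>*]\<close> is \<open>'a symalg fract\<close>.
\<close>

typedef (overloaded) ('a::euclidean_space) symalg = "{f :: 'a \<Rightarrow> real. real_polynomial_function f}"
  morphisms sa_fun Abs_symalg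
  by blast

setup_lifting type_definition_symalg

lemma sa_fun_polynomial: "real_polynomial_function (sa_fun p)"
  using sa_fun by blast

instantiation symalg :: (euclidean_space) comm_ring_1
begin

lift_definition zero_symalg :: "'a symalg" is "\<lambda>_. 0" by blast
lift_definition one_symalg :: "'a symalg" is "\<lambda>_. 1" by blast
lift_definition plus_symalg :: "'a symalg \<Rightarrow> 'a symalg \<Rightarrow> 'a symalg" is "\<lambda>f g x. f x + g x" by blast
lift_definition minus_symalg :: "'a symalg \<Rightarrow> 'a symalg \<Rightarrow> 'a symalg" is "\<lambda>f g x. f x - g x" by blast
lift_definition uminus_symalg :: "'a symalg \<Rightarrow> 'a symalg" is "\<lambda>f x. - f x" by blast
lift_definition times_symalg :: "'a symalg \<Rightarrow> 'a symalg \<Rightarrow> 'a symalg" is "\<lambda>f g x. f x * g x" by blast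

instance
proof
  show "(0::'a symalg) \<noteq> 1"
    by transfer (auto dest: fun_cong)
qed (transfer; simp add: fun_eq_iff algebra_simps)+

end

lemma real_polynomial_function_finite_zeros:
  fixes f :: "real \<Rightarrow> real"
  assumes "real_polynomial_function f" "f x \<noteq> 0"
  shows "finite {t. f t = 0}"
proof -
  obtain a n where f: "f = (\<lambda>t. \<Sum>i\<le>n. a i * t ^ i)"
    using assms(1) real_polynomial_function_iff_sum by blast
  then obtain k where "k \<le> n" "a k \<noteq> 0"
    using assms(2) by (metis (no_types, lifting) atMost_iff mult_zero_left sum.neutral)
  then show ?thesis
    unfolding f using polyfun_roots_finite by blast
qed

instance symalg :: (euclidean_space) idom
proof
  fix p q :: "'a symalg"
  assume "p \<noteq> 0" "q \<noteq> 0"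
  then show "p * q \<noteq> 0"
  proof (transfer)
    fix f g :: "'a \<Rightarrow> real"
    assume f: "real_polynomial_function f" and g: "real_polynomial_function g"
      and "f \<noteq> (\<lambda>_. 0)" "g \<noteq> (\<lambda>_. 0)"
    then obtain a b where ab: "f a \<noteq> 0" "g b \<noteq> 0" by (auto simp: fun_eq_iff)
    define l where "l t = a + t *\<^sub>R (b - a)" for t :: real
    have l: "polynomial_function l"
      unfolding l_def
      by (intro polynomial_function_add polynomial_function_const polynomial_function_bounded_linear
          bounded_linear_scaleR_left)
    have "finite {t. (f \<circ> l) t = 0}"
      by (rule real_polynomial_function_finite_zeros[OF real_polynomial_function_compose[OF l f], of 0])
        (use ab in \<open>simp add: l_def\<close>)
    moreover have "finite {t. (g \<circ> l) t = 0}"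
      by (rule real_polynomial_function_finite_zeros[OF real_polynomial_function_compose[OF l g], of 1])
        (use ab in \<open>simp add: l_def\<close>)
    ultimately have "finite ({t. (f \<circ> l) t = 0} \<union> {t. (g \<circ> l) t = 0})" by simp
    then obtain t where "t \<notin> {t. (f \<circ> l) t = 0} \<union> {t. (g \<circ> l) t = 0}"
      using ex_new_if_finite infinite_UNIV_char_0 by blast
    then have "f (l t) * g (l t) \<noteq> 0" by simp
    then show "(\<lambda>x. f x * g x) \<noteq> (\<lambda>_. 0)" by (metis (no_types, lifting))
  qed
qed

lift_definition sa_const :: "real \<Rightarrow> 'a::euclidean_space symalg" is "\<lambda>c _. c" by blast

text \<open>The linear form on \<open>V\<close> given by a vector, under the identification \<open>V\<^sup>* = V\<close>.\<close>

lift_definition sa_form :: "'a::euclidean_space \<Rightarrow> 'a symalg" is "inner"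
  using bounded_linear_inner_right by blast

definition in_symalg :: "'a::euclidean_space symalg \<Rightarrow> 'a symalg fract" where
  "in_symalg p = Fract p 1"

text \<open>Polynomials are finitely supported functions from monomials (exponent vectors) to coefficients.\<close>

type_synonym mpoly = "(nat \<Rightarrow>\<^sub>0 nat) \<Rightarrow>\<^sub>0 real"

definition poly_ring :: "nat \<Rightarrow> mpoly set" where
  "poly_ring m = {p. \<forall>\<alpha>\<in>Poly_Mapping.keys p. Poly_Mapping.keys \<alpha> \<subseteq> {1..m}}"

definition var :: "nat \<Rightarrow> mpoly" where
  "var i = Poly_Mapping.single (Poly_Mapping.single i 1) 1"

section \<open>Multi-fans\<close>

text \<open>
  The weights \<open>w\<close> and vectors \<open>\<lambda>\<close> are total functions, of which only the values of \<open>w\<close> on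
  \<open>n\<close>-subsets of \<open>[m]\<close> and of \<open>\<lambda>\<close> on \<open>[m]\<close> are ever used. The vertex set \<open>A\<close> and the dimension
  \<open>d\<close> are parameters because of the projected multi-fans.
\<close>

definition max_simplices :: "nat set \<Rightarrow> nat \<Rightarrow> (nat set \<Rightarrow> real) \<Rightarrow> nat set set" where
  "max_simplices A d w = {I. I \<subseteq> A \<and> card I = d \<and> w I \<noteq> 0}"

definition faces :: "nat set \<Rightarrow> nat \<Rightarrow> (nat set \<Rightarrow> real) \<Rightarrow> nat set set" where
  "faces A d w = {F. \<exists>I\<in>max_simplices A d w. F \<subseteq> I}"

definition multifan :: "nat \<Rightarrow> (nat set \<Rightarrow> real) \<Rightarrow> (nat \<Rightarrow> 'a::euclidean_space) \<Rightarrow> bool" where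
  "multifan m w lam \<longleftrightarrow>
    (\<forall>I\<in>max_simplices {1..m} DIM('a) w. inj_on lam I \<and> independent (lam ` I) \<and> span (lam ` I) = UNIV)"

section \<open>The underlying chain\<close>

definition ordered_basis :: "'a::euclidean_space list \<Rightarrow> bool" where
  "ordered_basis bs \<longleftrightarrow> distinct bs \<and> independent (set bs) \<and> span (set bs) = UNIV"

text \<open>
  An orientation of \<open>V\<close> is given by an ordered basis \<open>bs\<close>; an ordered basis is positive if the
  matrix of its coordinates with respect to \<open>bs\<close> has positive determinant.
\<close>

definition positive_basis :: "'a::euclidean_space list \<Rightarrow> 'a list \<Rightarrow> bool" where
  "positive_basis bs vs \<longleftrightarrow> ordered_basis vs \<and>
    0 < Determinant.det (Matrix.mat (length bs) (length bs)
          (\<lambda>(i, j). representation (set bs) (vs ! j) (bs ! i)))"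

text \<open>
  In a chain, a finite set of vertices stands for the simplex oriented by the increasing order
  of its vertices. So the oriented simplex \<open>I\<close> of a multi-fan is \<open>I\<close> or \<open>-I\<close>.
\<close>

type_synonym chain = "nat set \<Rightarrow>\<^sub>0 real"

definition boundary :: "chain \<Rightarrow> chain" where
  "boundary c = (\<Sum>I\<in>Poly_Mapping.keys c. \<Sum>k<card I.
     Poly_Mapping.single (I - {sorted_list_of_set I ! k}) ((-1) ^ k * Poly_Mapping.lookup c I))"

definition orient_sign :: "'a::euclidean_space list \<Rightarrow> (nat \<Rightarrow> 'a) \<Rightarrow> nat set \<Rightarrow> real" where
  "orient_sign bs lam I = (if positive_basis bs (map lam (sorted_list_of_set I)) then 1 else -1)"

definition underlying_chain ::
  "'a::euclidean_space list \<Rightarrow> nat \<Rightarrow> (nat set \<Rightarrow> real) \<Rightarrow> (nat \<Rightarrow> 'a) \<Rightarrow> chain" where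
  "underlying_chain bs m w lam =
    (\<Sum>I\<in>max_simplices {1..m} DIM('a) w. Poly_Mapping.single I (w I * orient_sign bs lam I))"

text \<open>\<open>boundary\<close> sends a vertex to the empty simplex, so it is the augmentation on 0-chains.\<close>

definition closed_chain :: "chain \<Rightarrow> bool" where
  "closed_chain c \<longleftrightarrow> boundary c = 0"

section \<open>The index map\<close>

definition dual_vector :: "(nat \<Rightarrow> 'a::euclidean_space) \<Rightarrow> nat set \<Rightarrow> nat \<Rightarrow> 'a" where
  "dual_vector lam I i = (THE u. \<forall>j\<in>I. inner u (lam j) = (if j = i then 1 else 0))"

definition restr :: "(nat \<Rightarrow> 'a::euclidean_space) \<Rightarrow> nat set \<Rightarrow> mpoly \<Rightarrow> 'a symalg" where
  "restr lam I p = (\<Sum>\<alpha>\<in>Poly_Mapping.keys p. sa_const (Poly_Mapping.lookup p \<alpha>) *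
     (\<Prod>i\<in>Poly_Mapping.keys \<alpha>. (if i \<in> I then sa_form (dual_vector lam I i) else 0) ^ Poly_Mapping.lookup \<alpha> i))"

definition abs_det :: "(nat \<Rightarrow> 'a::euclidean_space) \<Rightarrow> nat set \<Rightarrow> real" where
  "abs_det lam I = measure lebesgue {\<Sum>i\<in>I. r i *\<^sub>R lam i | r. \<forall>i\<in>I. 0 \<le> r i \<and> r i \<le> 1}"

definition index_map ::
  "nat \<Rightarrow> (nat set \<Rightarrow> real) \<Rightarrow> (nat \<Rightarrow> 'a::euclidean_space) \<Rightarrow> mpoly \<Rightarrow> 'a symalg fract" where
  "index_map m w lam p = (\<Sum>I\<in>max_simplices {1..m} DIM('a) w.
     in_symalg (sa_const (w I) * restr lam I p) /
     in_symalg (sa_const (abs_det lam I) * (\<Prod>i\<in>I. restr lam I (var i))))"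

section \<open>Completeness\<close>

text \<open>
  The elements of \<open>V/U\<close> are the cosets of the subspace \<open>U\<close>. A multi-fan in \<open>V/U\<close> is given by
  representatives \<open>\<lambda>(i) \<in> V\<close> of its vectors; the linear combination of the classes of the
  \<open>\<lambda>(i)\<close> with coefficients \<open>r\<^sub>i\<close> is the class of \<open>\<Sum>r\<^sub>i\<lambda>(i)\<close>.
\<close>

definition coset :: "'a::euclidean_space set \<Rightarrow> 'a \<Rightarrow> 'a set" where
  "coset U v = {v + u | u. u \<in> U}"

definition quotient_span :: "'a::euclidean_space set \<Rightarrow> (nat \<Rightarrow> 'a) \<Rightarrow> nat set \<Rightarrow> 'a set set" where
  "quotient_span U lam F = {coset U (\<Sum>i\<in>F. r i *\<^sub>R lam i) | r. True}"

definition quotient_cone :: "'a::euclidean_space set \<Rightarrow> (nat \<Rightarrow> 'a) \<Rightarrow> nat set \<Rightarrow> 'a set set" where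
  "quotient_cone U lam I = {coset U (\<Sum>i\<in>I. r i *\<^sub>R lam i) | r. \<forall>i\<in>I. 0 \<le> r i}"

definition generic ::
  "nat set \<Rightarrow> nat \<Rightarrow> (nat set \<Rightarrow> real) \<Rightarrow> 'a::euclidean_space set \<Rightarrow> (nat \<Rightarrow> 'a) \<Rightarrow> 'a set \<Rightarrow> bool" where
  "generic A d w U lam x \<longleftrightarrow> x \<in> range (coset U) \<and>
    (\<forall>F\<in>faces A d w. card F < d \<longrightarrow> x \<notin> quotient_span U lam F)"

definition multiplicity_at ::
  "nat set \<Rightarrow> nat \<Rightarrow> (nat set \<Rightarrow> real) \<Rightarrow> 'a::euclidean_space set \<Rightarrow> (nat \<Rightarrow> 'a) \<Rightarrow> 'a set \<Rightarrow> real" where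
  "multiplicity_at A d w U lam x =
    (\<Sum>I | I \<in> max_simplices A d w \<and> x \<in> quotient_cone U lam I. w I)"

text \<open>For \<open>d = 0\<close> the space has a single point, so \<open>pre_complete\<close> holds automatically.\<close>

definition pre_complete ::
  "nat set \<Rightarrow> nat \<Rightarrow> (nat set \<Rightarrow> real) \<Rightarrow> 'a::euclidean_space set \<Rightarrow> (nat \<Rightarrow> 'a) \<Rightarrow> bool" where
  "pre_complete A d w U lam \<longleftrightarrow>
    (\<forall>x y. generic A d w U lam x \<longrightarrow> generic A d w U lam y \<longrightarrow>
       multiplicity_at A d w U lam x = multiplicity_at A d w U lam y)"

definition complete_multifan :: "nat \<Rightarrow> (nat set \<Rightarrow> real) \<Rightarrow> (nat \<Rightarrow> 'a::euclidean_space) \<Rightarrow> bool" where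
  "complete_multifan m w lam \<longleftrightarrow>
    (\<forall>J\<in>faces {1..m} DIM('a) w.
       pre_complete ({1..m} - J) (DIM('a) - card J) (\<lambda>J'. w (J \<union> J')) (span (lam ` J)) lam)"

end

theory Submission
  imports Defs
begin

text \<open>
  All three conditions are equivalent to the balancing condition at walls: for every \<open>(n-1)\<close>-set
  \<open>F\<close> and normal vector \<open>e\<close> of \<open>\<lambda>(F)\<close>, the sum of \<open>w(F \<union> {i}) sgn \<langle>e, \<lambda>(i)\<rangle>\<close> over \<open>i\<close> vanishes.

  Expanding the determinant of an ordered basis along one column shows that this sum is, up to
  sign, the coefficient of \<open>F\<close> in the boundary of \<open>w\<^sub>c\<^sub>h\<close>. The index map sends \<open>\<Prod>\<^sub>j\<^sub>\<in>\<^sub>F x\<^sub>j\<close> to a nonzero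
  multiple of the sum divided by \<open>e\<close>, so polynomiality forces balancing. Conversely the poles of
  \<open>\<pi>\<^sub>!(x)\<close> along each hyperplane \<open>e = 0\<close> are simple, and modulo \<open>e\<close> the terms of the simplices
  containing a wall \<open>F\<close> differ only by the factors in the balancing sum, so the poles cancel.

  Pre-completeness of the one-dimensional projections is balancing itself. Conversely, a generic
  point can be moved to any other along a segment, after perturbing its end point, so that only
  one wall hyperplane is crossed at a time, and the jump of the multiplicity there is a combination
  of balancing sums.
\<close>

text \<open>The definitions speak of Lebesgue volumes, of determinants in a fixed basis and of
  cosets; what they share is the sign of \<open>e \<bullet> lam i\<close> at a wall \<open>F\<close>
  with normal \<open>e\<close>. In the index map this sign is a height divided by its absolute
  value: the volume belonging to \<open>insert i F\<close> is \<open>s\<close> times the absolute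
  value of \<open>e \<bullet> lam i\<close>, with \<open>s\<close> independent of \<open>i\<close>,
  while the dual vector of \<open>i\<close> is \<open>e\<close> divided by
  \<open>e \<bullet> lam i\<close>. Poles are simple because at most one dual vector of a simplex is
  a multiple of \<open>e\<close>. The remaining ones restrict to the hyperplane as the basis dual to
  the vectors of \<open>F\<close>, which does not see \<open>i\<close>; hence the agreement of the
  terms modulo \<open>e\<close>. For completeness the obstacle is that cones are closed: a point on
  a wall is counted from both sides, so the multiplicity is irregular there even when it agrees on
  the two sides. Giving wall points the mean value repairs this, and the comparison of generic
  points becomes local constancy along a connected segment.\<close>

no_notation Matrix.scalar_prod (infix "\<bullet>" 70)
no_notation Matrix.vec_index (infixl "$" 100)

section \<open>Volumes of parallelepipeds\<close>

text \<open>
  The library has the volume of a linear image only on \<open>real ^ 'n\<close> with a well-ordered index type;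
  \<open>coord\<close> is such a type with \<open>DIM('a)\<close> elements.
\<close>

typedef (overloaded) ('a::euclidean_space) coord = "{..<DIM('a)}"
  by (auto intro: exI[of _ 0])

lemma card_coord: "CARD('a::euclidean_space coord) = DIM('a)"
  using type_definition.card[OF type_definition_coord] by simp

instance coord :: (euclidean_space) finite
  by standard
    (metis finite_imageI finite_lessThan type_definition.Abs_image[OF type_definition_coord])

instantiation coord :: (euclidean_space) wellorder
begin

definition less_eq_coord :: "'a coord \<Rightarrow> 'a coord \<Rightarrow> bool" where
  "less_eq_coord i j \<longleftrightarrow> Rep_coord i \<le> Rep_coord j"

definition less_coord :: "'a coord \<Rightarrow> 'a coord \<Rightarrow> bool" where
  "less_coord i j \<longleftrightarrow> Rep_coord i < Rep_coord j"

instance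
proof
  fix P :: "'a coord \<Rightarrow> bool" and a
  assume *: "\<And>x. (\<And>y. y < x \<Longrightarrow> P y) \<Longrightarrow> P x"
  show "P a"
    by (induction a rule: measure_induct_rule[of Rep_coord]) (metis * less_coord_def)
qed (auto simp: less_eq_coord_def less_coord_def Rep_coord_inject)

end

text \<open>Enumerating the orthonormal basis makes coordinate boxes correspond to coordinate boxes
  of equal volume, and \<open>lborel\<close> is determined by its values on boxes. Compactness
  provides Borel measurability of both sets; only images of a cube will be measured.\<close>

lemma coordinate_isometry:
  obtains \<phi> :: "real^('a::euclidean_space coord) \<Rightarrow> 'a"
  where "linear \<phi>" "bij \<phi>" "\<And>S. compact S \<Longrightarrow> measure lebesgue (\<phi> ` S) = measure lebesgue S"
proof -
  have "card (UNIV::'a coord set) = card (Basis::'a set)"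
    by (simp add: card_coord)
  then obtain b :: "'a coord \<Rightarrow> 'a" where b: "bij_betw b UNIV Basis"
    using finite_same_card_bij[of "UNIV::'a coord set" "Basis::'a set"] by auto
  define \<phi> :: "real^('a coord) \<Rightarrow> 'a" where "\<phi> x = (\<Sum>k\<in>UNIV. (x $ k) *\<^sub>R b k)" for x
  have bB: "b k \<in> Basis" for k
    using b by (auto simp: bij_betw_def)
  have inj: "b k = b l \<longleftrightarrow> k = l" for k l
    using b by (auto simp: bij_betw_def inj_on_def)
  have comp: "\<phi> x \<bullet> b k = x $ k" for x k
  proof -
    have "\<phi> x \<bullet> b k = (\<Sum>l\<in>UNIV. if l = k then x $ l else 0)"
      unfolding \<phi>_def by (simp add: inner_sum_left inner_Basis bB inj if_distrib cong: if_cong)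
    then show ?thesis by simp
  qed
  have lin: "linear \<phi>"
    unfolding \<phi>_def by (intro linearI) (auto simp: sum.distrib scaleR_add_left scaleR_sum_right)
  have "inj \<phi>"
  proof (rule injI)
    fix x y :: "real^('a coord)" assume "\<phi> x = \<phi> y"
    then have "x $ k = y $ k" for k using comp[of x k] comp[of y k] by simp
    then show "x = y" by (simp add: Finite_Cartesian_Product.vec_eq_iff)
  qed
  moreover have "\<exists>x. y = \<phi> x" for y
  proof -
    have "\<phi> (\<chi> k. y \<bullet> b k) = (\<Sum>k\<in>UNIV. (y \<bullet> b k) *\<^sub>R b k)" by (simp add: \<phi>_def)
    also have "\<dots> = (\<Sum>c\<in>Basis. (y \<bullet> c) *\<^sub>R c)"
      by (rule sum.reindex_bij_betw[OF b])
    also have "\<dots> = y" by (rule euclidean_representation)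
    finally show ?thesis by metis
  qed
  ultimately have bij: "bij \<phi>"
    by (metis bijI surj_def)
  have cont: "continuous_on S \<phi>" for S
    by (rule linear_continuous_on) (use lin linear_conv_bounded_linear in blast)
  have [measurable]: "\<phi> \<in> borel_measurable borel"
    by (rule borel_measurable_continuous_onI[OF cont])
  have eq: "lborel = distr lborel borel \<phi>"
  proof (rule lborel_eqI)
    fix l u :: 'a
    assume le: "\<And>c. c \<in> Basis \<Longrightarrow> l \<bullet> c \<le> u \<bullet> c"
    have "(\<forall>c\<in>Basis. P c) \<longleftrightarrow> (\<forall>k. P (b k))" for P
      using b unfolding bij_betw_def by (metis bB image_iff)
    then have pre: "\<phi> -` box l u = box (\<chi> k. l \<bullet> b k) (\<chi> k. u \<bullet> b k)"
      by (auto simp: box_def Basis_vec_def inner_axis comp)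
    have "emeasure (distr lborel borel \<phi>) (box l u) = emeasure lborel (\<phi> -` box l u)"
      by (subst emeasure_distr) auto
    also have "\<dots> = (\<Prod>c\<in>Basis. ((\<chi> k. u \<bullet> b k) - (\<chi> k. l \<bullet> b k) :: real^('a coord)) \<bullet> c)"
      unfolding pre by (subst emeasure_lborel_box) (auto simp: Basis_vec_def inner_axis le bB)
    also have "(\<Prod>c\<in>Basis. ((\<chi> k. u \<bullet> b k) - (\<chi> k. l \<bullet> b k) :: real^('a coord)) \<bullet> c)
        = (\<Prod>k\<in>UNIV. (u - l) \<bullet> b k)"
      by (simp add: Basis_vec_def UNION_singleton_eq_range prod.reindex axis_eq_axis inj_on_def
          inner_axis inner_diff_left)
    also have "\<dots> = (\<Prod>c\<in>Basis. (u - l) \<bullet> c)"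
      by (rule prod.reindex_bij_betw[OF b])
    finally show "emeasure (distr lborel borel \<phi>) (box l u) = ennreal (\<Prod>c\<in>Basis. (u - l) \<bullet> c)" .
  qed simp
  have "measure lebesgue (\<phi> ` S) = measure lebesgue S" if S: "compact S" for S
  proof -
    have "compact (\<phi> ` S)" by (rule compact_continuous_image[OF cont S])
    then have [measurable]: "\<phi> ` S \<in> sets borel" "S \<in> sets borel"
      using S by (auto intro: borel_compact)
    have "\<phi> -` (\<phi> ` S) = S" using bij by (simp add: bij_is_inj inj_vimage_image_eq)
    then have "measure lborel (\<phi> ` S) = measure lborel S"
      by (subst eq, subst measure_distr) auto
    then show ?thesis by (simp add: measure_completion)
  qed
  with lin bij that show thesis by blast
qed

definition is_basis :: "(nat \<Rightarrow> 'a::euclidean_space) \<Rightarrow> nat set \<Rightarrow> bool" where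
  "is_basis lam I \<longleftrightarrow> inj_on lam I \<and> independent (lam ` I) \<and> span (lam ` I) = UNIV"

lemma is_basis_finite: "is_basis lam I \<Longrightarrow> finite I"
  unfolding is_basis_def by (metis finite_imageD independent_imp_finite)

lemma is_basis_card: "is_basis lam I \<Longrightarrow> card I = DIM('a)" for lam :: "nat \<Rightarrow> 'a::euclidean_space"
  unfolding is_basis_def by (metis card_image dim_UNIV dim_span_eq_card_independent)

lemma is_basis_sum_eq_0:
  assumes "is_basis lam I" "(\<Sum>i\<in>I. c i *\<^sub>R lam i) = 0" "i \<in> I"
  shows "c i = 0"
proof -
  have inj: "inj_on lam I" and ind: "independent (lam ` I)" and fin: "finite I"
    using assms(1) is_basis_finite by (auto simp: is_basis_def)
  have "(\<Sum>v\<in>lam ` I. c (the_inv_into I lam v) *\<^sub>R v) = (\<Sum>i\<in>I. c i *\<^sub>R lam i)"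
    using inj by (simp add: sum.reindex the_inv_into_f_f)
  then have "c (the_inv_into I lam (lam i)) = 0"
    using ind fin assms by (intro independentD[of "lam ` I" "lam ` I"]) auto
  then show ?thesis using inj assms by (simp add: the_inv_into_f_f)
qed

text \<open>The vector \<open>g\<close> is the generalised cross product of the vectors of
  \<open>F\<close>: a determinant with these as all but one of its rows is linear in the remaining
  row. The point is that one \<open>g\<close> computes the volumes for all \<open>i\<close>.\<close>

lemma abs_det_insert:
  fixes lam :: "nat \<Rightarrow> 'a::euclidean_space"
  assumes "finite F" "card F = DIM('a) - 1"
  obtains g where "\<And>j. j \<in> F \<Longrightarrow> g \<bullet> lam j = 0"
    "\<And>i. i \<notin> F \<Longrightarrow> abs_det lam (insert i F) = \<bar>g \<bullet> lam i\<bar>"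
    "\<And>i. i \<notin> F \<Longrightarrow> is_basis lam (insert i F) \<Longrightarrow> g \<bullet> lam i \<noteq> 0"
proof -
  obtain \<phi> :: "real^('a coord) \<Rightarrow> 'a" where lin: "linear \<phi>" and bij: "bij \<phi>"
    and meas: "\<And>S. compact S \<Longrightarrow> measure lebesgue (\<phi> ` S) = measure lebesgue S"
    using coordinate_isometry by blast
  define \<psi> where "\<psi> = inv_into UNIV \<phi>"
  have inj': "inj \<psi>" and \<phi>\<psi>: "\<phi> (\<psi> v) = v" and \<psi>\<phi>: "\<psi> (\<phi> x) = x" for v x
    unfolding \<psi>_def using bij by (auto simp: bij_is_surj surj_imp_inj_inv surj_f_inv_f bij_is_inj)
  have lin': "linear \<psi>"
  proof (rule linearI)
    show "\<psi> (u + v) = \<psi> u + \<psi> v" for u v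
      using \<psi>\<phi>[of "\<psi> u + \<psi> v"] by (simp add: linear_add[OF lin] \<phi>\<psi>)
    show "\<psi> (c *\<^sub>R v) = c *\<^sub>R \<psi> v" for c v
      using \<psi>\<phi>[of "c *\<^sub>R \<psi> v"] by (simp add: linear_scale[OF lin] \<phi>\<psi>)
  qed
  \<comment> \<open>The row kept free for the variable vector. Any row will do, since its position
    affects only the sign of the determinant.\<close>
  define k0 :: "'a coord" where "k0 = undefined"
  have "card (UNIV - {k0}) = card F"
    by (simp add: card_coord assms)
  then obtain \<tau> where \<tau>: "bij_betw \<tau> (UNIV - {k0}) F"
    using finite_same_card_bij[of "UNIV - {k0}" F] assms by auto
  define G where "G v = Determinants.det (\<chi> k. if k = k0 then \<psi> v else \<psi> (lam (\<tau> k)))" for v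
  have linG: "linear G"
  proof (rule linearI)
    show "G (u + v) = G u + G v" for u v
      unfolding G_def using Determinants.det_row_add[of k0 "\<lambda>_. \<psi> u" "\<lambda>_. \<psi> v" "\<lambda>k. \<psi> (lam (\<tau> k))"]
      by (simp add: linear_add[OF lin'] cong: if_cong)
    show "G (c *\<^sub>R v) = c *\<^sub>R G v" for c v
      unfolding G_def using Determinants.det_row_mul[of k0 c "\<lambda>_. \<psi> v" "\<lambda>k. \<psi> (lam (\<tau> k))"]
      by (simp add: linear_scale[OF lin'] scalar_mult_eq_scaleR cong: if_cong)
  qed
  \<comment> \<open>The adjoint of a real-valued linear map, applied to 1, is the vector
    representing the map.\<close>
  define g where "g = adjoint G 1"
  have g: "g \<bullet> v = G v" for v
    using adjoint_works[OF linG, of v 1] by (simp add: g_def inner_commute)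
  have orth: "g \<bullet> lam j = 0" if j: "j \<in> F" for j
  proof -
    obtain k where k: "k \<noteq> k0" "\<tau> k = j"
      using bij_betw_imp_surj_on[OF \<tau>] j by blast
    show ?thesis unfolding g G_def
      by (rule Determinants.det_identical_rows[of k k0]) (use k in \<open>auto simp: Finite_Cartesian_Product.row_def Finite_Cartesian_Product.vec_eq_iff\<close>)
  qed
  have main: "abs_det lam (insert i F) = \<bar>g \<bullet> lam i\<bar> \<and> (is_basis lam (insert i F) \<longrightarrow> g \<bullet> lam i \<noteq> 0)"
    if i: "i \<notin> F" for i
  proof -
    define \<rho> where "\<rho> k = (if k = k0 then i else \<tau> k)" for k
    have \<rho>: "bij_betw \<rho> UNIV (insert i F)"
    proof -
      have "bij_betw \<rho> (UNIV - {k0}) F"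
        using \<tau> bij_betw_cong[of "UNIV - {k0}" \<rho> \<tau> F] by (simp add: \<rho>_def)
      then have "bij_betw \<rho> ((UNIV - {k0}) \<union> {k0}) (F \<union> {\<rho> k0})"
        by (intro notIn_Un_bij_betw) (use i in \<open>auto simp: \<rho>_def\<close>)
      then show ?thesis by (simp add: \<rho>_def)
    qed
    define L :: "real^('a coord) \<Rightarrow> 'a" where "L x = (\<Sum>k\<in>UNIV. (x $ k) *\<^sub>R lam (\<rho> k))" for x
    have linL: "linear L"
      unfolding L_def by (intro linearI) (auto simp: sum.distrib scaleR_add_left scaleR_sum_right)
    have L_sum: "L x = (\<Sum>j\<in>insert i F. (x $ the_inv_into UNIV \<rho> j) *\<^sub>R lam j)" for x
    proof -
      have "L x = (\<Sum>k\<in>UNIV. (x $ the_inv_into UNIV \<rho> (\<rho> k)) *\<^sub>R lam (\<rho> k))"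
        using \<rho> by (simp add: L_def the_inv_into_f_f bij_betw_def)
      also have "\<dots> = (\<Sum>j\<in>insert i F. (x $ the_inv_into UNIV \<rho> j) *\<^sub>R lam j)"
        by (rule sum.reindex_bij_betw[OF \<rho>])
      finally show ?thesis .
    qed
    have par: "{\<Sum>j\<in>insert i F. r j *\<^sub>R lam j | r. \<forall>j\<in>insert i F. 0 \<le> r j \<and> r j \<le> 1} = L ` cbox 0 1"
    proof (intro equalityI subsetI)
      fix x assume "x \<in> {\<Sum>j\<in>insert i F. r j *\<^sub>R lam j | r. \<forall>j\<in>insert i F. 0 \<le> r j \<and> r j \<le> 1}"
      then obtain r where r: "x = (\<Sum>j\<in>insert i F. r j *\<^sub>R lam j)" "\<forall>j\<in>insert i F. 0 \<le> r j \<and> r j \<le> 1"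
        by blast
      have "L (\<chi> k. r (\<rho> k)) = x"
        unfolding L_def r(1) using sum.reindex_bij_betw[OF \<rho>, of "\<lambda>j. r j *\<^sub>R lam j"] by simp
      moreover have "(\<chi> k. r (\<rho> k)) \<in> cbox 0 (1::real^('a coord))"
        using r(2) \<rho> by (auto simp: mem_box_cart bij_betw_def)
      ultimately show "x \<in> L ` cbox 0 1" by blast
    next
      fix x assume "x \<in> L ` cbox 0 1"
      then obtain y :: "real^('a coord)" where "x = L y" "\<And>k. 0 \<le> y $ k \<and> y $ k \<le> 1"
        by (auto simp: mem_box_cart)
      then show "x \<in> {\<Sum>j\<in>insert i F. r j *\<^sub>R lam j | r. \<forall>j\<in>insert i F. 0 \<le> r j \<and> r j \<le> 1}"
        unfolding L_sum by (intro CollectI exI[of _ "\<lambda>j. y $ the_inv_into UNIV \<rho> j"]) simp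
    qed
    define T where "T = \<psi> \<circ> L"
    have linT: "linear T" unfolding T_def by (rule linear_compose[OF linL lin'])
    \<comment> \<open>\<open>matrix T\<close> has the vectors as columns, whereas \<open>G\<close>
      has them as rows.\<close>
    have "Determinants.det (matrix T) = Determinants.det (Finite_Cartesian_Product.transpose (matrix T))" by simp
    also have "Finite_Cartesian_Product.transpose (matrix T) = (\<chi> k. \<psi> (lam (\<rho> k)))"
    proof -
      have "L (axis k 1) = lam (\<rho> k)" for k
        by (simp add: L_def axis_def if_distrib[of "\<lambda>x. x *\<^sub>R _"] cong: if_cong)
      then show ?thesis by (simp add: Finite_Cartesian_Product.vec_eq_iff Finite_Cartesian_Product.transpose_def matrix_def T_def)
    qed
    also have "\<dots> = (\<chi> k. if k = k0 then \<psi> (lam i) else \<psi> (lam (\<tau> k)))"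
      using \<tau> by (auto simp: Finite_Cartesian_Product.vec_eq_iff \<rho>_def bij_betw_def)
    finally have det: "Determinants.det (matrix T) = g \<bullet> lam i" by (simp add: g G_def)
    have box: "measure lebesgue (cbox 0 (1::real^('a coord))) = 1"
    proof -
      have "(0::real^('a coord)) \<in> cbox 0 1" by (simp add: mem_box_cart)
      then have "cbox 0 (1::real^('a coord)) \<noteq> {}" by blast
      from content_cbox_cart[OF this] show ?thesis by simp
    qed
    have "compact (T ` cbox 0 1)"
      by (intro compact_continuous_image compact_cbox linear_continuous_on)
        (use linT linear_conv_bounded_linear in blast)
    moreover have "L ` cbox 0 1 = \<phi> ` T ` cbox 0 1"
      by (simp add: T_def image_comp \<phi>\<psi> comp_def)
    ultimately have "abs_det lam (insert i F) = measure lebesgue (T ` cbox 0 1)"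
      unfolding abs_det_def par by (simp add: meas)
    also have "\<dots> = \<bar>Determinants.det (matrix T)\<bar> * measure lebesgue (cbox 0 (1::real^('a coord)))"
      by (rule measure_linear_image[OF linT]) auto
    finally have "abs_det lam (insert i F) = \<bar>g \<bullet> lam i\<bar>"
      by (simp add: det box)
    moreover have "g \<bullet> lam i \<noteq> 0" if bas: "is_basis lam (insert i F)"
    proof -
      have "x = 0" if "L x = 0" for x
      proof -
        have "x $ the_inv_into UNIV \<rho> j = 0" if "j \<in> insert i F" for j
          using is_basis_sum_eq_0[OF bas, of "\<lambda>j. x $ the_inv_into UNIV \<rho> j"] \<open>L x = 0\<close> that
          unfolding L_sum by blast
        moreover have "the_inv_into UNIV \<rho> (\<rho> k) = k" "\<rho> k \<in> insert i F" for k
          using \<rho> by (auto simp: the_inv_into_f_f bij_betw_def)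
        ultimately have "x $ k = 0" for k by metis
        then show ?thesis by (simp add: Finite_Cartesian_Product.vec_eq_iff)
      qed
      then have "inj L" using linear_injective_0[OF linL] by blast
      then have "inj T" unfolding T_def using inj' by (rule inj_compose[rotated])
      then show ?thesis using det_nz_iff_inj[OF linT] det by simp
    qed
    ultimately show ?thesis by blast
  qed
  show thesis
    by (rule that[of g]) (use orth main in blast)+
qed

section \<open>Dual bases\<close>

lemma is_basis_inner_eqI:
  assumes "is_basis lam I" "\<And>j. j \<in> I \<Longrightarrow> u \<bullet> lam j = v \<bullet> lam j"
  shows "u = v"
proof -
  have "x \<in> span (lam ` I) \<Longrightarrow> (u - v) \<bullet> x = 0" for x
  proof (induction rule: span_induct)
    case (step x)
    then show ?case using assms(2) by (auto simp: inner_diff_left)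
  next
    case base
    show ?case by (auto simp: subspace_def inner_add_right)
  qed
  then have "(u - v) \<bullet> (u - v) = 0" using assms(1) by (auto simp: is_basis_def)
  then show ?thesis by simp
qed

lemma dual_vector_inner:
  assumes "is_basis lam I" "j \<in> I"
  shows "dual_vector lam I i \<bullet> lam j = (if j = i then 1 else 0)"
proof -
  have "\<exists>u. \<forall>j\<in>I. u \<bullet> lam j = (if j = i then 1 else 0)"
  proof (cases "i \<in> I")
    case True
    obtain f where f: "linear f" "\<forall>x\<in>lam ` I. f x = (if x = lam i then 1 else (0::real))"
      using linear_independent_extend[of "lam ` I" "\<lambda>x. if x = lam i then 1 else (0::real)"] assms(1)
      by (auto simp: is_basis_def)
    have "adjoint f 1 \<bullet> lam j = (if j = i then 1 else 0)" if "j \<in> I" for j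
    proof -
      have "adjoint f 1 \<bullet> lam j = f (lam j)"
        using adjoint_works[OF f(1), of "lam j" 1] by (simp add: inner_commute)
      moreover have "lam j = lam i \<longleftrightarrow> j = i"
        using assms(1) that True by (auto simp: is_basis_def inj_on_def)
      ultimately show ?thesis using f(2) that by simp
    qed
    then show ?thesis by blast
  qed (auto intro!: exI[of _ 0])
  then have "\<exists>!u. \<forall>j\<in>I. u \<bullet> lam j = (if j = i then 1 else 0)"
    using is_basis_inner_eqI[OF assms(1)] by (metis (no_types, lifting))
  from theI'[OF this] assms(2) show ?thesis unfolding dual_vector_def by blast
qed

lemma dual_vector_eqI:
  assumes "is_basis lam I" "\<And>j. j \<in> I \<Longrightarrow> u \<bullet> lam j = (if j = i then 1 else 0)"
  shows "dual_vector lam I i = u"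
  by (rule is_basis_inner_eqI[OF assms(1)]) (simp add: dual_vector_inner[OF assms(1)] assms(2))

lemma dual_vector_expansion:
  assumes "is_basis lam I"
  shows "(\<Sum>k\<in>I. (dual_vector lam I k \<bullet> x) *\<^sub>R lam k) = x"
proof -
  have fin: "finite I" by (rule is_basis_finite[OF assms])
  have "x \<in> span (lam ` I)" using assms by (auto simp: is_basis_def)
  then show ?thesis
  proof (induction rule: span_induct)
    case (step x)
    then obtain i where i: "i \<in> I" "x = lam i" by blast
    have "(\<Sum>k\<in>I. (dual_vector lam I k \<bullet> x) *\<^sub>R lam k) = (\<Sum>k\<in>I. if k = i then lam k else 0)"
      by (rule sum.cong) (use i in \<open>auto simp: dual_vector_inner[OF assms]\<close>)
    then show ?case using i fin by simp
  next
    case base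
    show ?case
      by (simp add: subspace_def inner_add_right scaleR_add_left sum.distrib flip: scaleR_scaleR scaleR_sum_right)
  qed
qed

lemma dual_vector_nonzero:
  assumes "is_basis lam I" "i \<in> I"
  shows "dual_vector lam I i \<noteq> 0"
  using dual_vector_inner[OF assms, of i] by auto

lemma is_basis_normal_inner:
  assumes "is_basis lam (insert i F)" "\<And>j. j \<in> F \<Longrightarrow> e \<bullet> lam j = 0" "e \<noteq> 0"
  shows "e \<bullet> lam i \<noteq> 0"
  using is_basis_inner_eqI[OF assms(1), of e 0] assms(2,3) by auto

text \<open>Both sides vanish on the vectors of \<open>F\<close> and pair to 1 with
  \<open>lam i\<close>. This is the factor of the denominator that causes the pole along
  \<open>e\<close>.\<close>

lemma dual_vector_normal:
  assumes "is_basis lam (insert i F)" "i \<notin> F" "\<And>j. j \<in> F \<Longrightarrow> e \<bullet> lam j = 0" "e \<noteq> 0"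
  shows "dual_vector lam (insert i F) i = (1 / (e \<bullet> lam i)) *\<^sub>R e"
  using is_basis_normal_inner[OF assms(1,3,4)] assms
  by (intro dual_vector_eqI[OF assms(1)]) auto

text \<open>The normals of a facet of a simplex form a line. This is how the normals obtained from
  determinants are compared with an arbitrary \<open>e\<close>.\<close>

lemma normal_parallel:
  assumes "is_basis lam (insert i F)" "i \<notin> F"
    "\<And>j. j \<in> F \<Longrightarrow> e \<bullet> lam j = 0" "e \<noteq> 0" "\<And>j. j \<in> F \<Longrightarrow> g \<bullet> lam j = 0"
  shows "g = ((g \<bullet> lam i) / (e \<bullet> lam i)) *\<^sub>R e"
  using is_basis_normal_inner[OF assms(1,3,4)] assms
  by (intro is_basis_inner_eqI[OF assms(1)]) auto

text \<open>Orthogonal projection onto the hyperplane of \<open>e\<close>. Composition with it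
  models reduction modulo the linear form \<open>e\<close> without passing to a smaller
  space.\<close>

definition proj :: "'a::euclidean_space \<Rightarrow> 'a \<Rightarrow> 'a" where
  "proj e x = x - ((e \<bullet> x) / (e \<bullet> e)) *\<^sub>R e"

lemma linear_proj: "linear (proj e)"
  unfolding proj_def by (intro linearI) (auto simp: algebra_simps inner_add_right add_divide_distrib)

lemma proj_inner: "v \<bullet> proj e x = proj e v \<bullet> x"
  by (simp add: proj_def inner_diff_left inner_diff_right inner_commute)

lemma inner_proj_self: "e \<bullet> proj e x = 0"
  by (simp add: proj_def inner_diff_right)

lemma proj_eq_0_D: "proj e x = 0 \<Longrightarrow> x = ((e \<bullet> x) / (e \<bullet> e)) *\<^sub>R e"
  by (simp add: proj_def)

text \<open>
  Since 0 is not a vertex, it can serve as an auxiliary vertex carrying a normal \<open>e\<close> of the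
  vectors of \<open>F\<close>. The dual vectors of \<open>insert 0 F\<close> are then the dual basis of \<open>F\<close> inside the
  hyperplane orthogonal to \<open>e\<close>.
\<close>

lemma is_basis_normal:
  assumes "is_basis lam (insert i F)" "i \<notin> F" "0 \<notin> F" "\<And>j. j \<in> F \<Longrightarrow> e \<bullet> lam j = 0" "e \<noteq> 0"
  shows "is_basis (lam(0 := e)) (insert 0 F)"
proof -
  have inj: "inj_on lam F" and ind: "independent (lam ` F)" and fin: "finite F"
    using assms(1) is_basis_finite[OF assms(1)] independent_mono[of "lam ` insert i F" "lam ` F"]
    by (auto simp: is_basis_def)
  have im: "(lam(0 := e)) ` F = lam ` F"
    by (rule image_cong) (use assms in auto)
  have "x \<in> span (lam ` F) \<Longrightarrow> e \<bullet> x = 0" for x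
  proof (induction rule: span_induct)
    case base
    show ?case by (auto simp: subspace_def inner_add_right)
  qed (use assms in auto)
  from this[of e] have e: "e \<notin> span (lam ` F)" using assms(5) by auto
  then have "e \<notin> lam ` F" by (metis span_base)
  then have "inj_on (lam(0 := e)) (insert 0 F)"
    using inj assms(3) im by (auto simp: inj_on_def)
  moreover have "(lam(0 := e)) ` insert 0 F = insert e (lam ` F)"
    unfolding image_insert im by simp
  moreover have indep: "independent (insert e (lam ` F))"
    using e ind by (simp add: independent_insert)
  moreover have "span (insert e (lam ` F)) = UNIV"
  proof -
    have "card (insert e (lam ` F)) = card (insert i F)"
      using \<open>e \<notin> lam ` F\<close> fin assms(2) inj by (simp add: card_image)
    also have "\<dots> = DIM('a)" by (rule is_basis_card[OF assms(1)])
    finally have "UNIV \<subseteq> span (insert e (lam ` F))"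
      by (intro card_ge_dim_independent indep) auto
    then show ?thesis by blast
  qed
  ultimately show ?thesis by (simp add: is_basis_def)
qed

text \<open>The projected vector is orthogonal to \<open>e\<close>, and its pairings with the
  vectors of \<open>F\<close> are unchanged because these lie in the hyperplane. The left-hand side
  does not mention \<open>i\<close>, so the projections coming from all simplices around the wall
  coincide.\<close>

lemma proj_dual_vector:
  assumes "is_basis lam (insert i F)" "i \<notin> F" "0 \<notin> F" "\<And>j. j \<in> F \<Longrightarrow> e \<bullet> lam j = 0" "e \<noteq> 0"
    and "k \<in> F"
  shows "dual_vector (lam(0 := e)) (insert 0 F) k = proj e (dual_vector lam (insert i F) k)"
proof (rule dual_vector_eqI[OF is_basis_normal[OF assms(1-5)]])
  fix j assume "j \<in> insert 0 F"
  then consider "j = 0" | "j \<in> F" "j \<noteq> 0" using assms(3) by auto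
  then show "proj e (dual_vector lam (insert i F) k) \<bullet> (lam(0 := e)) j = (if j = k then 1 else 0)"
  proof cases
    case 1
    then have "j \<noteq> k" using assms(3,6) by metis
    then show ?thesis using 1 inner_proj_self[of e] by (simp add: inner_commute)
  next
    case 2
    then show ?thesis
      using assms(4) dual_vector_inner[OF assms(1), of j k]
      by (simp add: proj_def inner_diff_left)
  qed
qed

section \<open>Localisation at a linear form\<close>

lemma real_polynomial_function_proj:
  assumes "real_polynomial_function f"
  shows "real_polynomial_function (\<lambda>x. f (proj e x))"
proof -
  have "polynomial_function (proj e)"
    using linear_proj linear_conv_bounded_linear polynomial_function_bounded_linear by blast
  from real_polynomial_function_compose[OF this assms] show ?thesis by (simp add: comp_def)
qed

text \<open>Restriction to the hyperplane, pulled back to the whole space. This keeps it an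
  endomorphism of one ring.\<close>

lift_definition sa_proj :: "'a::euclidean_space \<Rightarrow> 'a symalg \<Rightarrow> 'a symalg" is
  "\<lambda>e f x. f (proj e x)"
  by (rule real_polynomial_function_proj)

lemma sa_proj_add: "sa_proj e (p + q) = sa_proj e p + sa_proj e q"
  by transfer simp

lemma sa_proj_diff: "sa_proj e (p - q) = sa_proj e p - sa_proj e q"
  by transfer simp

lemma sa_proj_mult: "sa_proj e (p * q) = sa_proj e p * sa_proj e q"
  by transfer simp

lemma sa_proj_0 [simp]: "sa_proj e 0 = 0"
  by transfer simp

lemma sa_proj_1 [simp]: "sa_proj e 1 = 1"
  by transfer simp

lemma sa_proj_const [simp]: "sa_proj e (sa_const c) = sa_const c"
  by transfer simp

lemma sa_proj_form [simp]: "sa_proj e (sa_form v) = sa_form (proj e v)"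
  by transfer (simp add: proj_inner fun_eq_iff)

lemma sa_proj_power: "sa_proj e (p ^ k) = sa_proj e p ^ k"
  by (induction k) (auto simp: sa_proj_mult)

lemma sa_proj_sum: "sa_proj e (\<Sum>i\<in>A. f i) = (\<Sum>i\<in>A. sa_proj e (f i))"
  by (induction A rule: infinite_finite_induct) (auto simp: sa_proj_add)

lemma sa_proj_prod: "sa_proj e (\<Prod>i\<in>A. f i) = (\<Prod>i\<in>A. sa_proj e (f i))"
  by (induction A rule: infinite_finite_induct) (auto simp: sa_proj_mult)

lemma sa_form_eq_0 [simp]: "sa_form v = 0 \<longleftrightarrow> v = 0"
  by transfer (metis inner_eq_zero_iff inner_zero_left)

lemma sa_const_eq_0 [simp]: "sa_const c = 0 \<longleftrightarrow> c = 0"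
  by transfer (auto simp: fun_eq_iff)

lemma sa_const_mult: "sa_const (a * b) = sa_const a * sa_const b"
  by transfer simp

lemma sa_const_sum: "sa_const (\<Sum>i\<in>A. f i) = (\<Sum>i\<in>A. sa_const (f i) :: 'a::euclidean_space symalg)"
proof -
  have "sa_const 0 = (0::'a symalg)" by simp
  moreover have "sa_const (a + b) = sa_const a + (sa_const b :: 'a symalg)" for a b
    by transfer simp
  ultimately show ?thesis by (induction A rule: infinite_finite_induct) auto
qed

lemma sa_form_scale: "sa_form (c *\<^sub>R v) = sa_const c * sa_form v"
  by transfer (simp add: fun_eq_iff)

lemma proj_self [simp]: "proj e e = 0"
  by (simp add: proj_def)

text \<open>Restriction to the hyperplane \<open>e = 0\<close> has kernel generated by the linear form \<open>e\<close>.\<close>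

lemma sa_form_dvd_iff:
  assumes "e \<noteq> 0"
  shows "sa_form e dvd p \<longleftrightarrow> sa_proj e p = 0"
proof
  assume "sa_form e dvd p"
  then show "sa_proj e p = 0" by (auto simp: dvd_def sa_proj_mult)
next
  \<comment> \<open>The quotient of \<open>f - f o proj e\<close> by \<open>e\<close> is built along
    the structure of \<open>f\<close>, with a discrete Leibniz rule for products. When
    \<open>f\<close> vanishes on the hyperplane it is the quotient of \<open>f\<close>
    itself.\<close>
  have poly: "\<exists>h. real_polynomial_function h \<and> (\<forall>x. f x - f (proj e x) = (e \<bullet> x) * h x)"
    if "real_polynomial_function f" for f
    using that
  proof (induction f rule: real_polynomial_function.induct)
    case (linear f)
    have "f x - f (proj e x) = (e \<bullet> x) * (f e / (e \<bullet> e))" for x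
      by (simp add: proj_def linear_diff[OF bounded_linear.linear[OF linear]]
          linear_scale[OF bounded_linear.linear[OF linear]])
    then show ?case using real_polynomial_function.intros(2) by (intro exI[of _ "\<lambda>_. f e / (e \<bullet> e)"]) blast
  next
    case (const c)
    show ?case by (rule exI[of _ "\<lambda>_. 0"]) auto
  next
    case (add f g)
    then obtain h k where hk: "real_polynomial_function h" "\<And>x. f x - f (proj e x) = (e \<bullet> x) * h x"
      "real_polynomial_function k" "\<And>x. g x - g (proj e x) = (e \<bullet> x) * k x" by blast
    have "f x + g x - (f (proj e x) + g (proj e x)) = (e \<bullet> x) * (h x + k x)" for x
      using hk(2,4)[of x] by (simp add: distrib_left)
    moreover have "real_polynomial_function (\<lambda>x. h x + k x)" using hk by blast
    ultimately show ?case by blast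
  next
    case (mult f g)
    then obtain h k where hk: "real_polynomial_function h" "\<And>x. f x - f (proj e x) = (e \<bullet> x) * h x"
      "real_polynomial_function k" "\<And>x. g x - g (proj e x) = (e \<bullet> x) * k x" by blast
    have "real_polynomial_function (\<lambda>x. f (proj e x))"
      using mult by (intro real_polynomial_function_proj)
    then have "real_polynomial_function (\<lambda>x. h x * g x + f (proj e x) * k x)"
      using hk mult by auto
    moreover have "f x * g x - f (proj e x) * g (proj e x)
        = (e \<bullet> x) * (h x * g x + f (proj e x) * k x)" for x
    proof -
      have "f x * g x - f (proj e x) * g (proj e x)
          = (f x - f (proj e x)) * g x + f (proj e x) * (g x - g (proj e x))"
        by (simp add: algebra_simps)
      then show ?thesis unfolding hk by (simp add: algebra_simps)
    qed
    ultimately show ?case by blast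
  qed
  assume "sa_proj e p = 0"
  then show "sa_form e dvd p"
    unfolding dvd_def
  proof (transfer fixing: e)
    fix f :: "'a \<Rightarrow> real"
    assume f: "real_polynomial_function f" and 0: "(\<lambda>x. f (proj e x)) = (\<lambda>_. 0)"
    obtain h where h: "real_polynomial_function h" "\<And>x. f x - f (proj e x) = (e \<bullet> x) * h x"
      using poly[OF f] by blast
    have "f (proj e x) = 0" for x using fun_cong[OF 0, of x] by simp
    then have "f = (\<lambda>x. (e \<bullet> x) * h x)" using h(2) by (simp add: fun_eq_iff)
    then show "\<exists>k\<in>Collect real_polynomial_function. f = (\<lambda>x. e \<bullet> x * k x)" using h(1) by blast
  qed
qed

section \<open>Fractions without a pole along a hyperplane\<close>

lemma in_symalg_0 [simp]: "in_symalg 0 = 0"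
  by (simp add: in_symalg_def Zero_fract_def)

lemma in_symalg_1 [simp]: "in_symalg 1 = 1"
  by (simp add: in_symalg_def One_fract_def)

lemma in_symalg_add: "in_symalg (p + q) = in_symalg p + in_symalg q"
  by (simp add: in_symalg_def)

lemma in_symalg_diff: "in_symalg (p - q) = in_symalg p - in_symalg q"
  by (simp add: in_symalg_def)

lemma in_symalg_mult: "in_symalg (p * q) = in_symalg p * in_symalg q"
  by (simp add: in_symalg_def)

lemma in_symalg_inject [simp]: "in_symalg p = in_symalg q \<longleftrightarrow> p = q"
  by (simp add: in_symalg_def eq_fract)

lemma in_symalg_eq_0 [simp]: "in_symalg p = 0 \<longleftrightarrow> p = 0"
  using in_symalg_inject[of p 0] by (simp del: in_symalg_inject)

lemma in_symalg_prod: "in_symalg (\<Prod>i\<in>A. f i) = (\<Prod>i\<in>A. in_symalg (f i))"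
  by (induction A rule: infinite_finite_induct) (auto simp: in_symalg_mult)

lemma in_symalg_sum: "in_symalg (\<Sum>i\<in>A. f i) = (\<Sum>i\<in>A. in_symalg (f i))"
  by (induction A rule: infinite_finite_induct) (auto simp: in_symalg_add)

text \<open>For \<open>e \<noteq> 0\<close> this is the local ring of the prime \<open>e\<close>:
  the denominator must not vanish identically on the hyperplane. \<open>vanishes_along\<close> is
  its maximal ideal.\<close>

definition regular_along :: "'a::euclidean_space \<Rightarrow> 'a symalg fract \<Rightarrow> bool" where
  "regular_along e x \<longleftrightarrow> (\<exists>a b. sa_proj e b \<noteq> 0 \<and> x = in_symalg a / in_symalg b)"

definition vanishes_along :: "'a::euclidean_space \<Rightarrow> 'a symalg fract \<Rightarrow> bool" where
  "vanishes_along e x \<longleftrightarrow>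
    (\<exists>a b. sa_proj e a = 0 \<and> sa_proj e b \<noteq> 0 \<and> x = in_symalg a / in_symalg b)"

lemma sa_proj_nonzero: "sa_proj e b \<noteq> 0 \<Longrightarrow> b \<noteq> 0"
  by auto

lemma regular_along_in_symalg: "regular_along e (in_symalg a)"
  unfolding regular_along_def by (intro exI[of _ a] exI[of _ 1]) auto

lemma regular_along_add:
  assumes "regular_along e x" "regular_along e y"
  shows "regular_along e (x + y)"
proof -
  obtain a b c d where *: "sa_proj e b \<noteq> 0" "x = in_symalg a / in_symalg b"
    "sa_proj e d \<noteq> 0" "y = in_symalg c / in_symalg d"
    using assms unfolding regular_along_def by blast
  then have "x + y = in_symalg (a * d + c * b) / in_symalg (b * d)"
    by (auto simp: in_symalg_add in_symalg_mult field_simps dest!: sa_proj_nonzero)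
  then show ?thesis unfolding regular_along_def using * by (metis mult_eq_0_iff sa_proj_mult)
qed

lemma regular_along_mult:
  assumes "regular_along e x" "regular_along e y"
  shows "regular_along e (x * y)"
proof -
  obtain a b c d where *: "sa_proj e b \<noteq> 0" "x = in_symalg a / in_symalg b"
    "sa_proj e d \<noteq> 0" "y = in_symalg c / in_symalg d"
    using assms unfolding regular_along_def by blast
  then have "x * y = in_symalg (a * c) / in_symalg (b * d)"
    by (auto simp: in_symalg_add in_symalg_mult field_simps dest!: sa_proj_nonzero)
  then show ?thesis unfolding regular_along_def using * by (metis mult_eq_0_iff sa_proj_mult)
qed

lemma regular_along_sum: "(\<And>i. i \<in> A \<Longrightarrow> regular_along e (f i)) \<Longrightarrow> regular_along e (\<Sum>i\<in>A. f i)"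
  using regular_along_in_symalg[of e 0]
  by (induction A rule: infinite_finite_induct) (auto intro: regular_along_add)

text \<open>Over the common denominator \<open>b * d\<close>, the numerator
  \<open>a * d - c * b\<close> restricts to zero.\<close>

lemma vanishes_along_diff:
  assumes "sa_proj e a = sa_proj e c" "sa_proj e b = sa_proj e d" "sa_proj e d \<noteq> 0"
  shows "vanishes_along e (in_symalg a / in_symalg b - in_symalg c / in_symalg d)"
proof -
  have "b \<noteq> 0" "d \<noteq> 0" using assms by auto
  then have "in_symalg a / in_symalg b - in_symalg c / in_symalg d
      = in_symalg (a * d - c * b) / in_symalg (b * d)"
    by (simp add: in_symalg_diff in_symalg_mult diff_frac_eq)
  moreover have "sa_proj e (a * d - c * b) = 0" "sa_proj e (b * d) \<noteq> 0"
    using assms by (auto simp: sa_proj_mult sa_proj_diff)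
  ultimately show ?thesis unfolding vanishes_along_def by blast
qed

text \<open>The numerator has \<open>e\<close> as a factor, which absorbs a simple pole.\<close>

lemma vanishes_along_divide:
  assumes "vanishes_along e x" "e \<noteq> 0"
  shows "regular_along e (x / in_symalg (sa_form e))"
proof -
  obtain a b where *: "sa_proj e a = 0" "sa_proj e b \<noteq> 0" "x = in_symalg a / in_symalg b"
    using assms unfolding vanishes_along_def by blast
  obtain k where "a = sa_form e * k"
    using * sa_form_dvd_iff[OF assms(2), of a] by (auto simp: dvd_def)
  then have "x / in_symalg (sa_form e) = in_symalg k / in_symalg b"
    using * assms(2) by (simp add: in_symalg_mult)
  then show ?thesis unfolding regular_along_def using * by blast
qed

text \<open>
  The linear forms are prime elements, so a denominator that is a product of linear forms can be
  cancelled factor by factor once the function has no pole along any of them.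
\<close>

lemma regular_everywhere_polynomial:
  assumes "\<And>e. e \<noteq> 0 \<Longrightarrow> regular_along e x" "0 \<notin> set es"
    "x * (\<Prod>e\<leftarrow>es. in_symalg (sa_form e)) \<in> range in_symalg"
  shows "x \<in> range in_symalg"
  using assms(2,3)
proof (induction es)
  case (Cons e es)
  define y where "y = x * (\<Prod>e\<leftarrow>es. in_symalg (sa_form e))"
  have e: "e \<noteq> 0" using Cons.prems by auto
  obtain N where N: "y * in_symalg (sa_form e) = in_symalg N"
    using Cons.prems(2) by (auto simp: y_def mult_ac)
  have "(\<Prod>e\<leftarrow>es. in_symalg (sa_form e)) = in_symalg (\<Prod>e\<leftarrow>es. sa_form e)"
    by (induction es) (auto simp: in_symalg_mult)
  then have "regular_along e y"
    unfolding y_def by (metis assms(1) e regular_along_mult regular_along_in_symalg)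
  then obtain a b where ab: "sa_proj e b \<noteq> 0" "y = in_symalg a / in_symalg b"
    unfolding regular_along_def by blast
  then have "b \<noteq> 0" by auto
  \<comment> \<open>Both are \<open>y * e * b\<close>. On the hyperplane the left-hand side vanishes
    and \<open>b\<close> does not, so \<open>e\<close> divides \<open>N\<close>: this is the
    primality of \<open>e\<close> at work.\<close>
  then have "in_symalg (a * sa_form e) = in_symalg (N * b)"
    using N ab by (simp add: in_symalg_mult field_simps)
  then have "sa_proj e (N * b) = 0"
    using sa_proj_mult[of e a "sa_form e"] by simp
  then have "sa_proj e N = 0" using ab(1) by (simp add: sa_proj_mult)
  then obtain k where "N = sa_form e * k"
    using sa_form_dvd_iff[OF e, of N] by (auto simp: dvd_def)
  then have "y = in_symalg k" using N e by (simp add: in_symalg_mult)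
  then show ?case using Cons by (auto simp: y_def)
qed simp

section \<open>Walls and the index map\<close>

lemma multifan_is_basis:
  fixes lam :: "nat \<Rightarrow> 'a::euclidean_space"
  assumes "multifan m w lam" "I \<in> max_simplices {1..m} DIM('a) w"
  shows "is_basis lam I"
  using assms by (simp add: multifan_def is_basis_def)

lemma finite_max_simplices: "finite A \<Longrightarrow> finite (max_simplices A d w)"
  by (rule finite_subset[of _ "Pow A"]) (auto simp: max_simplices_def)

text \<open>Sets that are not faces are harmless: they have no cofacets and contribute empty sums.
  In dimension 1 the only wall is the empty set.\<close>

definition walls :: "nat \<Rightarrow> (nat \<Rightarrow> 'a::euclidean_space) \<Rightarrow> 'a \<Rightarrow> nat set set" where
  "walls m lam e = {F. F \<subseteq> {1..m} \<and> card F = DIM('a) - 1 \<and> (\<forall>j\<in>F. e \<bullet> lam j = 0)}"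

definition cofacets :: "nat \<Rightarrow> (nat set \<Rightarrow> real) \<Rightarrow> nat set \<Rightarrow> nat set" where
  "cofacets m w F = {i \<in> {1..m} - F. w (insert i F) \<noteq> 0}"

text \<open>In a multi-fan the normals of an \<open>F\<close> that has a cofacet form a line, so for
  fixed \<open>F\<close> the choice of \<open>e\<close> changes the sum only by a sign.\<close>

definition wall_balanced :: "nat \<Rightarrow> (nat set \<Rightarrow> real) \<Rightarrow> (nat \<Rightarrow> 'a::euclidean_space) \<Rightarrow> bool" where
  "wall_balanced m w lam \<longleftrightarrow>
    (\<forall>e F. e \<noteq> 0 \<longrightarrow> F \<in> walls m lam e \<longrightarrow> (\<Sum>i\<in>cofacets m w F. w (insert i F) * sgn (e \<bullet> lam i)) = 0)"

lemma finite_cofacets: "finite (cofacets m w F)"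
  by (simp add: cofacets_def)

lemma finite_walls: "finite (walls m lam e)"
  by (rule finite_subset[of _ "Pow {1..m}"]) (auto simp: walls_def)

lemma wall_finite: "F \<in> walls m lam e \<Longrightarrow> finite F"
  by (auto simp: walls_def intro: finite_subset)

lemma cofacet_max_simplex:
  fixes lam :: "nat \<Rightarrow> 'a::euclidean_space"
  assumes "F \<in> walls m lam e" "i \<in> cofacets m w F"
  shows "insert i F \<in> max_simplices {1..m} DIM('a) w"
  using assms wall_finite[OF assms(1)] by (auto simp: walls_def cofacets_def max_simplices_def)

lemma cofacet_notin: "i \<in> cofacets m w F \<Longrightarrow> i \<notin> F"
  by (simp add: cofacets_def)

text \<open>A simplex has at most one facet in the hyperplane, since two would make \<open>e\<close>
  orthogonal to a basis. A simplex with such a facet is therefore the same as a pair of a wall and a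
  cofacet.\<close>

lemma sum_by_walls:
  fixes lam :: "nat \<Rightarrow> 'a::euclidean_space" and f :: "nat set \<Rightarrow> 'b::comm_monoid_add"
  assumes "multifan m w lam" "e \<noteq> 0"
  shows "(\<Sum>I\<in>max_simplices {1..m} DIM('a) w. f I) =
    (\<Sum>I | I \<in> max_simplices {1..m} DIM('a) w \<and> (\<forall>i\<in>I. I - {i} \<notin> walls m lam e). f I)
    + (\<Sum>F\<in>walls m lam e. \<Sum>i\<in>cofacets m w F. f (insert i F))"
proof -
  let ?M = "max_simplices {1..m} DIM('a) w"
  let ?N = "{I \<in> ?M. \<exists>i\<in>I. I - {i} \<in> walls m lam e}"
  let ?S = "SIGMA F:walls m lam e. cofacets m w F"
  have "bij_betw (\<lambda>(F, i). insert i F) ?S ?N"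
    unfolding bij_betw_def
  proof
    show "inj_on (\<lambda>(F, i). insert i F) ?S"
    proof (rule inj_onI, clarify)
      fix F i F' i'
      assume F: "F \<in> walls m lam e" "i \<in> cofacets m w F" "F' \<in> walls m lam e" "i' \<in> cofacets m w F'"
        and eq: "insert i F = insert i' F'"
      have "i = i'"
      proof (rule ccontr)
        assume "i \<noteq> i'"
        then have "i \<in> F'" using eq by blast
        then have "e \<bullet> lam i = 0" using F by (simp add: walls_def)
        moreover have "is_basis lam (insert i F)"
          using multifan_is_basis[OF assms(1) cofacet_max_simplex[OF F(1,2)]] .
        ultimately show False
          using is_basis_normal_inner[of lam i F e] F(1) assms(2) by (auto simp: walls_def)
      qed
      then show "F = F' \<and> i = i'"
        using eq F cofacet_notin by (metis Diff_insert_absorb)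
    qed
    show "(\<lambda>(F, i). insert i F) ` ?S = ?N"
    proof (intro equalityI subsetI)
      fix I assume "I \<in> (\<lambda>(F, i). insert i F) ` ?S"
      then obtain F i where F: "F \<in> walls m lam e" "i \<in> cofacets m w F" "I = insert i F" by auto
      then have "I - {i} = F" using cofacet_notin by auto
      then show "I \<in> ?N" using cofacet_max_simplex[OF F(1,2)] F by auto
    next
      fix I assume "I \<in> ?N"
      then obtain i where i: "I \<in> ?M" "i \<in> I" "I - {i} \<in> walls m lam e" by blast
      then have "i \<in> cofacets m w (I - {i})"
        by (auto simp: max_simplices_def cofacets_def insert_absorb)
      then have "(I - {i}, i) \<in> ?S" using i by simp
      then show "I \<in> (\<lambda>(F, i). insert i F) ` ?S" using i(2) by (auto simp: insert_absorb intro!: rev_image_eqI)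
    qed
  qed
  from sum.reindex_bij_betw[OF this, of f]
  have "(\<Sum>I\<in>?N. f I) = (\<Sum>(F, i)\<in>?S. f (insert i F))"
    by (simp add: case_prod_unfold)
  also have "\<dots> = (\<Sum>F\<in>walls m lam e. \<Sum>i\<in>cofacets m w F. f (insert i F))"
    by (rule sum.Sigma[symmetric]) (auto simp: finite_walls finite_cofacets)
  finally have *: "(\<Sum>I\<in>?N. f I) = \<dots>" .
  have "?M = {I \<in> ?M. \<forall>i\<in>I. I - {i} \<notin> walls m lam e} \<union> ?N" by blast
  then have "(\<Sum>I\<in>?M. f I) = (\<Sum>I\<in>{I \<in> ?M. \<forall>i\<in>I. I - {i} \<notin> walls m lam e} \<union> ?N. f I)" by simp
  also have "\<dots> = (\<Sum>I\<in>{I \<in> ?M. \<forall>i\<in>I. I - {i} \<notin> walls m lam e}. f I) + (\<Sum>I\<in>?N. f I)"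
    by (rule sum.union_disjoint) (auto simp: finite_max_simplices)
  finally show ?thesis unfolding * .
qed

text \<open>Volume is base times height, and the base depends only on \<open>F\<close>. Formally
  \<open>s\<close> is the absolute value of the factor between \<open>e\<close> and the cross
  product of \<open>F\<close>; if no simplex contains \<open>F\<close>, any positive
  \<open>s\<close> serves.\<close>

lemma abs_det_wall:
  fixes lam :: "nat \<Rightarrow> 'a::euclidean_space"
  assumes "finite F" "card F = DIM('a) - 1" "\<And>j. j \<in> F \<Longrightarrow> e \<bullet> lam j = 0" "e \<noteq> 0"
  shows "\<exists>s>0. \<forall>i. i \<notin> F \<longrightarrow> is_basis lam (insert i F) \<longrightarrow> abs_det lam (insert i F) = s * \<bar>e \<bullet> lam i\<bar>"
proof (cases "\<exists>i. i \<notin> F \<and> is_basis lam (insert i F)")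
  case True
  then obtain i where i: "i \<notin> F" "is_basis lam (insert i F)" by blast
  obtain g where g: "\<And>j. j \<in> F \<Longrightarrow> g \<bullet> lam j = 0"
    "\<And>i. i \<notin> F \<Longrightarrow> abs_det lam (insert i F) = \<bar>g \<bullet> lam i\<bar>"
    "\<And>i. i \<notin> F \<Longrightarrow> is_basis lam (insert i F) \<Longrightarrow> g \<bullet> lam i \<noteq> 0"
    by (rule abs_det_insert[OF assms(1,2), of lam]) blast
  define c where "c = (g \<bullet> lam i) / (e \<bullet> lam i)"
  have gc: "g = c *\<^sub>R e"
    unfolding c_def by (rule normal_parallel[OF i(2,1) assms(3,4) g(1)])
  have "c \<noteq> 0" using g(3)[OF i(1)] i(2) gc by auto
  then show ?thesis using g(2)
    by (intro exI[of _ "\<bar>c\<bar>"]) (auto simp: gc abs_mult)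
qed (auto intro: exI[of _ 1])

text \<open>A dual vector \<open>?u\<close> is a normal of the facet opposite to \<open>i\<close>,
  and with respect to it the height of \<open>lam i\<close> is 1, so the volume is the scale
  \<open>s\<close> itself.\<close>

lemma abs_det_pos:
  fixes lam :: "nat \<Rightarrow> 'a::euclidean_space"
  assumes "is_basis lam I"
  shows "abs_det lam I > 0"
proof -
  have fin: "finite I" and card: "card I = DIM('a)"
    using is_basis_finite[OF assms] is_basis_card[OF assms] by auto
  then obtain i where i: "i \<in> I"
    by (metis DIM_positive card.empty ex_in_conv less_irrefl)
  let ?u = "dual_vector lam I i"
  have "\<exists>s>0. \<forall>k. k \<notin> I - {i} \<longrightarrow> is_basis lam (insert k (I - {i})) \<longrightarrow>
      abs_det lam (insert k (I - {i})) = s * \<bar>?u \<bullet> lam k\<bar>"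
    by (rule abs_det_wall)
      (use fin card i dual_vector_inner[OF assms] dual_vector_nonzero[OF assms] in auto)
  then obtain s where "s > 0" "abs_det lam (insert i (I - {i})) = s * \<bar>?u \<bullet> lam i\<bar>"
    using assms i by (auto simp: insert_absorb)
  then show ?thesis using i dual_vector_inner[OF assms i, of i] by (simp add: insert_absorb)
qed

lemma restr_var:
  assumes "i \<in> I"
  shows "restr lam I (var i) = sa_form (dual_vector lam I i)"
proof -
  have "sa_const 1 = (1 :: 'a symalg)" by transfer simp
  then show ?thesis using assms by (simp add: restr_def var_def)
qed

section \<open>The terms of the index map along a hyperplane\<close>

definition index_term :: "(nat set \<Rightarrow> real) \<Rightarrow> (nat \<Rightarrow> 'a::euclidean_space) \<Rightarrow> mpoly \<Rightarrow> nat set \<Rightarrow> 'a symalg fract" where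
  "index_term w lam p I = in_symalg (sa_const (w I) * restr lam I p) /
     in_symalg (sa_const (abs_det lam I) * (\<Prod>i\<in>I. sa_form (dual_vector lam I i)))"

lemma index_map_alt:
  "index_map m w lam p = (\<Sum>I\<in>max_simplices {1..m} DIM('a) w. index_term w (lam :: nat \<Rightarrow> 'a::euclidean_space) p I)"
  by (simp add: index_map_def index_term_def restr_var)

text \<open>What is left of an index term after the weight, the volume and the factor of the vertex
  \<open>i\<close> are taken out. With \<open>lam(0 := e)\<close> and \<open>i = 0\<close> it also
  represents the common value of these residues on the hyperplane.\<close>

definition wall_residue :: "(nat \<Rightarrow> 'a::euclidean_space) \<Rightarrow> mpoly \<Rightarrow> nat \<Rightarrow> nat set \<Rightarrow> 'a symalg fract" where
  "wall_residue lam p i F = in_symalg (restr lam (insert i F) p) /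
     in_symalg (\<Prod>j\<in>F. sa_form (dual_vector lam (insert i F) j))"

text \<open>Write \<open>a\<close> for \<open>e \<bullet> lam i\<close>. The volume,
  \<open>s\<close> times the absolute value of \<open>a\<close>, and the dual vector
  \<open>e / a\<close> multiply to \<open>s * sgn a * e\<close>; this is how signs enter the index
  map.\<close>

lemma index_term_wall:
  fixes lam :: "nat \<Rightarrow> 'a::euclidean_space"
  assumes "finite F" "i \<notin> F" "is_basis lam (insert i F)" "\<And>j. j \<in> F \<Longrightarrow> e \<bullet> lam j = 0" "e \<noteq> 0"
    and "s > 0" "abs_det lam (insert i F) = s * \<bar>e \<bullet> lam i\<bar>"
  shows "index_term w lam p (insert i F) =
    in_symalg (sa_const (w (insert i F) * sgn (e \<bullet> lam i) / s)) * wall_residue lam p i F / in_symalg (sa_form e)"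
proof -
  let ?a = "e \<bullet> lam i" and ?P = "\<Prod>j\<in>F. sa_form (dual_vector lam (insert i F) j)"
  have a: "?a \<noteq> 0" using is_basis_normal_inner[OF assms(3-5)] by simp
  have P: "?P \<noteq> 0" using assms(1) dual_vector_nonzero[OF assms(3)] by simp
  have prod: "sa_const (abs_det lam (insert i F)) * (\<Prod>j\<in>insert i F. sa_form (dual_vector lam (insert i F) j))
      = sa_const (s * \<bar>?a\<bar> / ?a) * sa_form e * ?P"
    using assms(1,2)
    by (simp add: dual_vector_normal[OF assms(3,2,4,5)] assms(7) sa_form_scale mult_ac
        flip: sa_const_mult)
  have "(w (insert i F) * sgn ?a / s) * (s * \<bar>?a\<bar> / ?a) = w (insert i F)"
    using a assms(6) by (simp add: sgn_if)
  then have "sa_const (w (insert i F)) = sa_const (w (insert i F) * sgn ?a / s) * (sa_const (s * \<bar>?a\<bar> / ?a) :: 'a symalg)"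
    by (simp flip: sa_const_mult)
  moreover have "in_symalg (sa_const (s * \<bar>?a\<bar> / ?a) :: 'a symalg) \<noteq> 0"
    using a assms(6) by simp
  ultimately show ?thesis
    unfolding index_term_def wall_residue_def prod in_symalg_mult
    using P assms(5) by (simp add: in_symalg_mult)
qed

text \<open>On the hyperplane the image of \<open>x_i\<close>, a multiple of \<open>e\<close>, dies,
  and the other images become the dual basis of \<open>F\<close>. The variables of \<open>p\<close>
  have positive index, so the auxiliary vertex 0 is never evaluated.\<close>

lemma restr_proj:
  assumes "is_basis lam (insert i F)" "i \<notin> F" "\<And>j. j \<in> F \<Longrightarrow> e \<bullet> lam j = 0" "e \<noteq> 0"
    and "F \<subseteq> {1..m}" "p \<in> poly_ring m"
  shows "sa_proj e (restr lam (insert i F) p) = restr (lam(0 := e)) (insert 0 F) p"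
proof -
  have F0: "0 \<notin> F" using assms(5) by auto
  have "sa_proj e (if k \<in> insert i F then sa_form (dual_vector lam (insert i F) k) else 0)
      = (if k \<in> insert 0 F then sa_form (dual_vector (lam(0 := e)) (insert 0 F) k) else 0)"
    if "k \<noteq> 0" for k
  proof -
    consider "k \<in> F" | "k = i" | "k \<notin> insert i F" by blast
    then show ?thesis
    proof cases
      case 1
      then show ?thesis using proj_dual_vector[OF assms(1,2) F0 assms(3,4)] by simp
    next
      case 2
      then show ?thesis using that assms(2)
        by (simp add: dual_vector_normal[OF assms(1-4)] linear_scale[OF linear_proj])
    next
      case 3
      then show ?thesis using that by simp
    qed
  qed
  moreover have "k \<noteq> 0" if "\<alpha> \<in> Poly_Mapping.keys p" "k \<in> Poly_Mapping.keys \<alpha>" for \<alpha> k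
    using assms(6) that by (force simp: poly_ring_def)
  ultimately show ?thesis
    unfolding restr_def sa_proj_sum sa_proj_mult sa_proj_prod sa_proj_power sa_proj_const
    by (intro sum.cong refl arg_cong2[of _ _ _ _ "(*)"] prod.cong) auto
qed

lemma proj_idem: "proj e (proj e x) = proj e x"
  using inner_proj_self[of e x] by (simp add: proj_def[of e "proj e x"])

lemma sa_proj_idem: "sa_proj e (sa_proj e q) = sa_proj e q"
  by transfer (simp add: proj_idem)

text \<open>Numerators and denominators agree on the hyperplane, and the denominator is nonzero
  there because its factors project to dual basis vectors.\<close>

lemma wall_residue_cong:
  assumes "is_basis lam (insert i F)" "i \<notin> F" "\<And>j. j \<in> F \<Longrightarrow> e \<bullet> lam j = 0" "e \<noteq> 0"
    and "F \<subseteq> {1..m}" "p \<in> poly_ring m"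
  shows "vanishes_along e (wall_residue lam p i F - wall_residue (lam(0 := e)) p 0 F)"
proof -
  have F0: "0 \<notin> F" using assms(5) by auto
  have fin: "finite F" using assms(5) finite_subset by blast
  let ?mu = "lam(0 := e)"
  have bas: "is_basis ?mu (insert 0 F)" by (rule is_basis_normal[OF assms(1,2) F0 assms(3,4)])
  have dual: "dual_vector ?mu (insert 0 F) j = proj e (dual_vector lam (insert i F) j)" if "j \<in> F" for j
    using proj_dual_vector[OF assms(1,2) F0 assms(3,4) that] .
  have *: "sa_proj e (\<Prod>j\<in>F. sa_form (dual_vector lam (insert i F) j))
      = (\<Prod>j\<in>F. sa_form (dual_vector ?mu (insert 0 F) j))"
    by (simp add: sa_proj_prod dual)
  have **: "sa_proj e (\<Prod>j\<in>F. sa_form (dual_vector ?mu (insert 0 F) j))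
      = (\<Prod>j\<in>F. sa_form (dual_vector ?mu (insert 0 F) j))"
    by (simp add: sa_proj_prod dual proj_idem)
  show ?thesis
    unfolding wall_residue_def
  proof (rule vanishes_along_diff)
    show "sa_proj e (restr lam (insert i F) p) = sa_proj e (restr ?mu (insert 0 F) p)"
      by (metis sa_proj_idem restr_proj[OF assms])
    show "sa_proj e (\<Prod>j\<in>F. sa_form (dual_vector lam (insert i F) j))
      = sa_proj e (\<Prod>j\<in>F. sa_form (dual_vector ?mu (insert 0 F) j))"
      unfolding * ** ..
    show "sa_proj e (\<Prod>j\<in>F. sa_form (dual_vector ?mu (insert 0 F) j)) \<noteq> 0"
      unfolding ** using fin dual_vector_nonzero[OF bas] by simp
  qed
qed

text \<open>A factor of the denominator vanishes on the hyperplane only if its dual vector is a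
  multiple of \<open>e\<close>; the opposite facet is then a wall.\<close>

lemma index_term_regular:
  fixes lam :: "nat \<Rightarrow> 'a::euclidean_space"
  assumes "is_basis lam I" "I \<subseteq> {1..m}" "\<And>i. i \<in> I \<Longrightarrow> I - {i} \<notin> walls m lam e"
  shows "regular_along e (index_term w lam p I)"
proof -
  have fin: "finite I" by (rule is_basis_finite[OF assms(1)])
  have "proj e (dual_vector lam I i) \<noteq> 0" if "i \<in> I" for i
  proof
    let ?u = "dual_vector lam I i"
    assume "proj e ?u = 0"
    then obtain c where c: "?u = c *\<^sub>R e" using proj_eq_0_D by blast
    then have "c \<noteq> 0" using dual_vector_nonzero[OF assms(1) that] by auto
    moreover have "?u \<bullet> lam j = 0" if "j \<in> I - {i}" for j
      using that dual_vector_inner[OF assms(1)] by auto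
    ultimately have "I - {i} \<in> walls m lam e"
      using assms(2) that fin is_basis_card[OF assms(1)] by (auto simp: walls_def c)
    then show False using assms(3) that by blast
  qed
  then have "sa_proj e (sa_const (abs_det lam I) * (\<Prod>i\<in>I. sa_form (dual_vector lam I i))) \<noteq> 0"
    using fin abs_det_pos[OF assms(1)] by (simp add: sa_proj_mult sa_proj_prod)
  then show ?thesis unfolding regular_along_def index_term_def by blast
qed

text \<open>At each wall the residues are compared with the common value \<open>?h\<close>. The
  differences are divisible by \<open>e\<close>, and the total coefficient of \<open>?h / e\<close>
  is the balancing sum divided by \<open>s\<close>.\<close>

lemma wall_balanced_regular:
  fixes lam :: "nat \<Rightarrow> 'a::euclidean_space"
  assumes fan: "multifan m w lam" and bal: "wall_balanced m w lam" and p: "p \<in> poly_ring m" and e: "e \<noteq> 0"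
  shows "regular_along e (index_map m w lam p)"
  unfolding index_map_alt sum_by_walls[OF fan e]
proof (rule regular_along_add; rule regular_along_sum)
  fix I assume "I \<in> {I \<in> max_simplices {1..m} DIM('a) w. \<forall>i\<in>I. I - {i} \<notin> walls m lam e}"
  then show "regular_along e (index_term w lam p I)"
    using multifan_is_basis[OF fan] by (intro index_term_regular[of _ _ m]) (auto simp: max_simplices_def)
next
  fix F assume F: "F \<in> walls m lam e"
  then have F': "finite F" "card F = DIM('a) - 1" "\<And>j. j \<in> F \<Longrightarrow> e \<bullet> lam j = 0" "F \<subseteq> {1..m}"
    using wall_finite by (auto simp: walls_def)
  have bas: "is_basis lam (insert i F)" if "i \<in> cofacets m w F" for i
    using multifan_is_basis[OF fan cofacet_max_simplex[OF F that]] .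
  obtain s where s: "s > 0" "\<And>i. i \<notin> F \<Longrightarrow> is_basis lam (insert i F) \<Longrightarrow> abs_det lam (insert i F) = s * \<bar>e \<bullet> lam i\<bar>"
    using abs_det_wall[OF F'(1,2) _ e, of lam] F'(3) by blast
  define c where "c i = w (insert i F) * sgn (e \<bullet> lam i) / s" for i
  let ?h = "wall_residue (lam(0 := e)) p 0 F"
  have "(\<Sum>i\<in>cofacets m w F. w (insert i F) * sgn (e \<bullet> lam i)) = 0"
    using bal e F by (simp add: wall_balanced_def)
  then have c: "(\<Sum>i\<in>cofacets m w F. c i) = 0"
    by (simp add: c_def flip: sum_divide_distrib)
  have "(\<Sum>i\<in>cofacets m w F. index_term w lam p (insert i F))
      = (\<Sum>i\<in>cofacets m w F. in_symalg (sa_const (c i)) * wall_residue lam p i F / in_symalg (sa_form e))"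
    unfolding c_def
    by (intro sum.cong refl index_term_wall F' bas e s cofacet_notin) auto
  also have "\<dots> = (\<Sum>i\<in>cofacets m w F. in_symalg (sa_const (c i)) *
        ((wall_residue lam p i F - ?h) / in_symalg (sa_form e)) + in_symalg (sa_const (c i)) * (?h / in_symalg (sa_form e)))"
    by (intro sum.cong refl) (simp add: diff_divide_distrib right_diff_distrib)
  also have "\<dots> = (\<Sum>i\<in>cofacets m w F. in_symalg (sa_const (c i)) *
        ((wall_residue lam p i F - ?h) / in_symalg (sa_form e)))
        + in_symalg (sa_const (\<Sum>i\<in>cofacets m w F. c i)) * (?h / in_symalg (sa_form e))"
    by (simp only: sum.distrib sum_distrib_right sa_const_sum in_symalg_sum)
  also have "\<dots> = (\<Sum>i\<in>cofacets m w F. in_symalg (sa_const (c i)) *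
        ((wall_residue lam p i F - ?h) / in_symalg (sa_form e)))"
    unfolding c by simp
  finally have *: "(\<Sum>i\<in>cofacets m w F. index_term w lam p (insert i F)) = \<dots>" .
  show "regular_along e (\<Sum>i\<in>cofacets m w F. index_term w lam p (insert i F))"
    unfolding *
    by (intro regular_along_sum regular_along_mult regular_along_in_symalg vanishes_along_divide
        wall_residue_cong[where m = m] bas e F' p cofacet_notin)
qed

text \<open>A single term is cleared by its own dual vectors, its volume being an invertible
  constant; for the sum the lists of linear forms are concatenated, with repetitions.\<close>

lemma index_map_denominator:
  fixes lam :: "nat \<Rightarrow> 'a::euclidean_space"
  assumes "multifan m w lam"
  shows "\<exists>es. 0 \<notin> set es \<and> index_map m w lam p * (\<Prod>e\<leftarrow>es. in_symalg (sa_form e)) \<in> range in_symalg"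
proof -
  have prod: "(\<Prod>e\<leftarrow>es. in_symalg (sa_form e)) \<in> range in_symalg" for es :: "'a list"
    by (induction es) (auto simp flip: in_symalg_mult in_symalg_1)
  have mult: "x * y \<in> range in_symalg" if "x \<in> range in_symalg" "y \<in> range in_symalg" for x y :: "'a symalg fract"
    using that by (auto simp flip: in_symalg_mult)
  have add: "x + y \<in> range in_symalg" if "x \<in> range in_symalg" "y \<in> range in_symalg" for x y :: "'a symalg fract"
    using that by (auto simp flip: in_symalg_add)
  have single: "\<exists>es. 0 \<notin> set es \<and> index_term w lam p I * (\<Prod>e\<leftarrow>es. in_symalg (sa_form e)) \<in> range in_symalg"
    if "I \<in> max_simplices {1..m} DIM('a) w" for I
  proof (intro exI conjI)
    have bas: "is_basis lam I" using multifan_is_basis[OF assms that] .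
    let ?es = "map (dual_vector lam I) (sorted_list_of_set I)"
    have fin: "finite I" by (rule is_basis_finite[OF bas])
    show "0 \<notin> set ?es" using dual_vector_nonzero[OF bas] fin by auto
    have "(\<Prod>e\<leftarrow>?es. in_symalg (sa_form e)) = (\<Prod>i\<in>I. in_symalg (sa_form (dual_vector lam I i)))"
      using fin by (simp add: comp_def prod.distinct_set_conv_list[symmetric])
    moreover have "(\<Prod>i\<in>I. in_symalg (sa_form (dual_vector lam I i))) \<noteq> 0"
      using fin dual_vector_nonzero[OF bas] by simp
    ultimately have "index_term w lam p I * (\<Prod>e\<leftarrow>?es. in_symalg (sa_form e))
        = in_symalg (sa_const (w I) * restr lam I p) / in_symalg (sa_const (abs_det lam I))"
      by (simp add: index_term_def in_symalg_mult in_symalg_prod)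
    also have "\<dots> = in_symalg (sa_const (w I) * restr lam I p * sa_const (1 / abs_det lam I))"
    proof -
      have "sa_const (1 / abs_det lam I) * sa_const (abs_det lam I) = (1 :: 'a symalg)"
        using abs_det_pos[OF bas] by (simp flip: sa_const_mult) (transfer, simp)
      then have "in_symalg (sa_const (1 / abs_det lam I) :: 'a symalg) * in_symalg (sa_const (abs_det lam I)) = 1"
        by (simp flip: in_symalg_mult)
      moreover have "in_symalg (sa_const (abs_det lam I) :: 'a symalg) \<noteq> 0"
        using abs_det_pos[OF bas] by simp
      ultimately show ?thesis by (simp add: in_symalg_mult divide_eq_eq mult.assoc)
    qed
    finally show "index_term w lam p I * (\<Prod>e\<leftarrow>?es. in_symalg (sa_form e)) \<in> range in_symalg" by simp
  qed
  have "finite N \<Longrightarrow> N \<subseteq> max_simplices {1..m} DIM('a) w \<Longrightarrow>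
    \<exists>es. 0 \<notin> set es \<and> (\<Sum>I\<in>N. index_term w lam p I) * (\<Prod>e\<leftarrow>es. in_symalg (sa_form e)) \<in> range in_symalg" for N
  proof (induction N rule: finite_induct)
    case empty
    show ?case by (intro exI[of _ "[]"]) (auto intro: image_eqI[of _ _ 0])
  next
    case (insert I N)
    then obtain es ds where es: "0 \<notin> set es"
      "(\<Sum>I\<in>N. index_term w lam p I) * (\<Prod>e\<leftarrow>es. in_symalg (sa_form e)) \<in> range in_symalg"
      and ds: "0 \<notin> set ds" "index_term w lam p I * (\<Prod>e\<leftarrow>ds. in_symalg (sa_form e)) \<in> range in_symalg"
      using single[of I] by auto
    have "(\<Sum>I\<in>insert I N. index_term w lam p I) * (\<Prod>e\<leftarrow>ds @ es. in_symalg (sa_form e))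
      = index_term w lam p I * (\<Prod>e\<leftarrow>ds. in_symalg (sa_form e)) * (\<Prod>e\<leftarrow>es. in_symalg (sa_form e))
      + (\<Sum>I\<in>N. index_term w lam p I) * (\<Prod>e\<leftarrow>es. in_symalg (sa_form e)) * (\<Prod>e\<leftarrow>ds. in_symalg (sa_form e))"
      using insert.hyps by (simp add: algebra_simps)
    also have "\<dots> \<in> range in_symalg"
      by (intro add mult prod es ds)
    finally show ?case using es ds by (intro exI[of _ "ds @ es"]) auto
  qed
  from this[OF finite_max_simplices subset_refl] show ?thesis by (simp add: index_map_alt)
qed

lemma wall_balanced_imp_index_map:
  fixes lam :: "nat \<Rightarrow> 'a::euclidean_space"
  assumes "multifan m w lam" "wall_balanced m w lam" "p \<in> poly_ring m"
  shows "index_map m w lam p \<in> range in_symalg"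
  using index_map_denominator[OF assms(1), of p] regular_everywhere_polynomial
    wall_balanced_regular[OF assms] by blast

text \<open>The test monomial is the product of the variables of \<open>F\<close>. It restricts to
  zero on simplices not containing \<open>F\<close>, and on the others it cancels every factor of
  the denominator except the one of the vertex opposite to \<open>F\<close>.\<close>

lemma index_map_imp_wall_balanced:
  fixes lam :: "nat \<Rightarrow> 'a::euclidean_space"
  assumes fan: "multifan m w lam" and range: "index_map m w lam ` poly_ring m \<subseteq> range in_symalg"
  shows "wall_balanced m w lam"
  unfolding wall_balanced_def
proof (intro allI impI)
  fix e :: 'a and F assume e: "e \<noteq> 0" and F: "F \<in> walls m lam e"
  then have F': "finite F" "card F = DIM('a) - 1" "\<And>j. j \<in> F \<Longrightarrow> e \<bullet> lam j = 0" "F \<subseteq> {1..m}"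
    using wall_finite by (auto simp: walls_def)
  have bas: "is_basis lam (insert i F)" if "i \<in> cofacets m w F" for i
    using multifan_is_basis[OF fan cofacet_max_simplex[OF F that]] .
  obtain s where s: "s > 0" "\<And>i. i \<notin> F \<Longrightarrow> is_basis lam (insert i F) \<Longrightarrow> abs_det lam (insert i F) = s * \<bar>e \<bullet> lam i\<bar>"
    using abs_det_wall[OF F'(1,2) _ e, of lam] F'(3) by blast
  define \<alpha> :: "nat \<Rightarrow>\<^sub>0 nat" where "\<alpha> = (\<Sum>j\<in>F. Poly_Mapping.single j 1)"
  have look: "Poly_Mapping.lookup \<alpha> k = (if k \<in> F then 1 else 0)" for k
    using F'(1) by (simp add: \<alpha>_def lookup_sum lookup_single when_def)
  then have keys: "Poly_Mapping.keys \<alpha> = F"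
    by (auto simp: in_keys_iff split: if_splits)
  define p :: mpoly where "p = Poly_Mapping.single \<alpha> 1"
  have "p \<in> poly_ring m" using F'(4) by (simp add: poly_ring_def p_def keys)
  have const1: "sa_const 1 = (1 :: 'a symalg)" by transfer simp
  have restr: "restr lam I p = (\<Prod>j\<in>F. if j \<in> I then sa_form (dual_vector lam I j) else 0)" for I
    by (simp add: restr_def p_def keys look const1)
  define c where "c i = w (insert i F) * sgn (e \<bullet> lam i) / s" for i
  have res: "wall_residue lam p i F = 1" if "i \<in> cofacets m w F" for i
    using F'(1) dual_vector_nonzero[OF bas[OF that]] by (simp add: wall_residue_def restr)
  have 0: "index_term w lam p I = 0" if "\<not> F \<subseteq> I" for I
  proof -
    obtain j where "j \<in> F" "j \<notin> I" using \<open>\<not> F \<subseteq> I\<close> by blast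
    then have "restr lam I p = 0" unfolding restr using F'(1) by (intro prod_zero) auto
    then show ?thesis by (simp add: index_term_def)
  qed
  have "index_map m w lam p = (\<Sum>I\<in>(\<lambda>i. insert i F) ` cofacets m w F. index_term w lam p I)"
    unfolding index_map_alt
  proof (rule sum.mono_neutral_right)
    show "(\<lambda>i. insert i F) ` cofacets m w F \<subseteq> max_simplices {1..m} DIM('a) w"
      using cofacet_max_simplex[OF F] by blast
    show "\<forall>I\<in>max_simplices {1..m} DIM('a) w - (\<lambda>i. insert i F) ` cofacets m w F. index_term w lam p I = 0"
    proof (intro ballI 0 notI)
      fix I assume I: "I \<in> max_simplices {1..m} DIM('a) w - (\<lambda>i. insert i F) ` cofacets m w F" and sub: "F \<subseteq> I"
      have "card I = DIM('a)" "finite I" using I by (auto simp: max_simplices_def intro: finite_subset)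
      then have "card (I - F) = 1" using F' sub by (simp add: card_Diff_subset)
      then obtain i where "I - F = {i}" by (auto simp: card_1_singleton_iff)
      then have "I = insert i F" "i \<notin> F" using sub by auto
      then have "i \<in> cofacets m w F" using I by (auto simp: cofacets_def max_simplices_def)
      then show False using I \<open>I = insert i F\<close> by blast
    qed
  qed (auto simp: finite_max_simplices)
  also have "\<dots> = (\<Sum>i\<in>cofacets m w F. index_term w lam p (insert i F))"
  proof -
    have "inj_on (\<lambda>i. insert i F) (cofacets m w F)"
      by (rule inj_onI) (metis cofacet_notin insertE insertI1)
    then show ?thesis by (simp add: sum.reindex)
  qed
  also have "\<dots> = (\<Sum>i\<in>cofacets m w F. in_symalg (sa_const (c i)) * wall_residue lam p i F / in_symalg (sa_form e))"
    unfolding c_def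
    by (intro sum.cong refl index_term_wall F' bas e s cofacet_notin) auto
  also have "\<dots> = in_symalg (sa_const (\<Sum>i\<in>cofacets m w F. c i)) / in_symalg (sa_form e)"
    by (simp add: res sa_const_sum in_symalg_sum sum_divide_distrib)
  finally obtain q where "in_symalg (sa_const (\<Sum>i\<in>cofacets m w F. c i)) / in_symalg (sa_form e) = in_symalg q"
    using range \<open>p \<in> poly_ring m\<close> by (metis (no_types, lifting) image_subset_iff rangeE)
  then have "in_symalg (sa_const (\<Sum>i\<in>cofacets m w F. c i)) = in_symalg (q * sa_form e)"
    using e by (simp add: in_symalg_mult divide_eq_eq del: in_symalg_inject)
  then have "sa_const (\<Sum>i\<in>cofacets m w F. c i) = q * sa_form e" by simp
  \<comment> \<open>On the hyperplane a multiple of \<open>e\<close> vanishes while a constant stays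
    the same, so the constant is 0.\<close>
  then have "sa_proj e (sa_const (\<Sum>i\<in>cofacets m w F. c i)) = 0" by (simp add: sa_proj_mult)
  then have "(\<Sum>i\<in>cofacets m w F. c i) = 0" by simp
  then show "(\<Sum>i\<in>cofacets m w F. w (insert i F) * sgn (e \<bullet> lam i)) = 0"
    using s(1) by (simp add: c_def flip: sum_divide_distrib)
qed

section \<open>The boundary of the underlying chain\<close>

text \<open>The index shift is that of \<open>mat_delete\<close>, so removing a vertex from a
  simplex matches removing a column from its matrix.\<close>

lemma sorted_list_of_set_remove_nth:
  assumes "finite I" "k < card I" "b < card I - 1"
  shows "sorted_list_of_set (I - {sorted_list_of_set I ! k}) ! b
    = sorted_list_of_set I ! (if b < k then b else Suc b)"
proof -
  let ?s = "sorted_list_of_set I"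
  have len: "length ?s = card I" by simp
  have split: "?s = take k ?s @ ?s ! k # drop (Suc k) ?s"
    using assms(2) by (simp add: id_take_nth_drop)
  have "distinct ?s" by simp
  then have notin: "?s ! k \<notin> set (take k ?s)"
    using split by (metis distinct_append disjoint_iff list.set_intros(1))
  have "sorted_list_of_set (I - {?s ! k}) = remove1 (?s ! k) ?s"
    using assms(1) by (rule sorted_list_of_set_remove)
  also have "\<dots> = take k ?s @ drop (Suc k) ?s"
    using notin by (subst (2) split) (simp add: remove1_append)
  finally show ?thesis
    using assms len by (auto simp: nth_append min_def)
qed

section \<open>Cofactor expansion and orientation signs\<close>

lemma linear_representation:
  assumes "independent B" "span B = UNIV"
  shows "linear (\<lambda>v. representation B v b)"
  by (rule linearI) (use assms in \<open>auto simp: representation_add representation_scale\<close>)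

definition coord_matrix :: "'a::euclidean_space list \<Rightarrow> 'a list \<Rightarrow> real mat" where
  "coord_matrix bs vs = Matrix.mat (length bs) (length bs) (\<lambda>(i, j). representation (set bs) (vs ! j) (bs ! i))"

text \<open>
  The cofactor expansion of the determinant along the column of \<open>v\<close>; it does not see at which
  position \<open>v\<close> is inserted into the vectors of \<open>F\<close>.
\<close>

definition cofactor_form :: "'a::euclidean_space list \<Rightarrow> (nat \<Rightarrow> 'a) \<Rightarrow> nat set \<Rightarrow> 'a \<Rightarrow> real" where
  "cofactor_form bs lam F v = (\<Sum>r<length bs. representation (set bs) v (bs ! r) * ((-1) ^ r *
     Determinant.det (Matrix.mat (length bs - 1) (length bs - 1) (\<lambda>(a, b).
       representation (set bs) (lam (sorted_list_of_set F ! b)) (bs ! (if a < r then a else Suc a))))))"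

lemma linear_cofactor_form:
  assumes "ordered_basis bs"
  shows "linear (cofactor_form bs lam F)"
proof -
  have lin: "linear (\<lambda>v. representation (set bs) v b)" for b
    using assms by (intro linear_representation) (auto simp: ordered_basis_def)
  then show ?thesis
    unfolding cofactor_form_def
    by (intro linearI)
      (simp_all add: linear_add[OF lin] linear_scale[OF lin] distrib_right sum.distrib sum_distrib_left mult.assoc)
qed

lemma cofactor_form_cong:
  assumes "finite F" "card F = length bs - 1" "\<And>j. j \<in> F \<Longrightarrow> lam j = mu j"
  shows "cofactor_form bs lam F = cofactor_form bs mu F"
proof -
  have "lam (sorted_list_of_set F ! b) = mu (sorted_list_of_set F ! b)" if "b < length bs - 1" for b
    using assms that by (intro assms(3)) (metis length_sorted_list_of_set nth_mem set_sorted_list_of_set)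
  then show ?thesis
    unfolding cofactor_form_def
    by (intro ext sum.cong refl arg_cong2[of _ _ _ _ "(*)"] arg_cong[of _ _ Determinant.det] cong_mat) auto
qed

text \<open>In the Laplace expansion along column \<open>k\<close> the sign splits: the part
  depending on the row belongs to the cofactor form, and \<open>(-1) ^ k\<close> is the sign with
  which the facet occurs in the boundary.\<close>

lemma det_coord_matrix_sorted:
  assumes "finite I" "card I = length bs" "k < card I"
  shows "Determinant.det (coord_matrix bs (map lam (sorted_list_of_set I)))
    = (-1) ^ k * cofactor_form bs lam (I - {sorted_list_of_set I ! k}) (lam (sorted_list_of_set I ! k))"
proof -
  let ?s = "sorted_list_of_set I" and ?n = "length bs"
  let ?A = "coord_matrix bs (map lam ?s)"
  have A: "?A \<in> carrier_mat ?n ?n" by (simp add: coord_matrix_def)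
  have len: "length ?s = ?n" using assms by simp
  have "mat_delete ?A r k = Matrix.mat (?n - 1) (?n - 1) (\<lambda>(a, b).
       representation (set bs) (lam (sorted_list_of_set (I - {?s ! k}) ! b)) (bs ! (if a < r then a else Suc a)))"
    if "r < ?n" for r
    using that assms len unfolding mat_delete_def coord_matrix_def
    by (intro cong_mat) (auto simp: sorted_list_of_set_remove_nth)
  then show ?thesis
    using assms len unfolding laplace_expansion_column[OF A assms(3)[unfolded assms(2)]] cofactor_def cofactor_form_def
    by (auto simp: coord_matrix_def sum_distrib_left power_add intro!: sum.cong)
qed

lemma nth_sorted_list_of_set:
  assumes "finite I" "i \<in> I"
  obtains k where "k < card I" "sorted_list_of_set I ! k = i"
  using assms by (metis in_set_conv_nth length_sorted_list_of_set set_sorted_list_of_set)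

text \<open>This is the expansion of a determinant with two equal columns: the outside vertex
  \<open>i\<close> is relabelled by \<open>lam j\<close>, which leaves the cofactor form of
  \<open>F\<close> unchanged.\<close>

lemma cofactor_form_eq_0:
  assumes "ordered_basis bs" "finite F" "Suc (card F) = length bs" "j \<in> F" "i \<notin> F"
  shows "cofactor_form bs lam F (lam j) = 0"
proof -
  let ?mu = "lam(i := lam j)" and ?I = "insert i F"
  let ?s = "sorted_list_of_set ?I"
  have I: "finite ?I" "card ?I = length bs" using assms by auto
  obtain k where k: "k < card ?I" "?s ! k = i" by (rule nth_sorted_list_of_set[OF I(1), of i]) auto
  obtain l where l: "l < card ?I" "?s ! l = j" by (rule nth_sorted_list_of_set[OF I(1), of j]) (use assms in auto)
  have "k \<noteq> l" using k l assms by auto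
  moreover have "map ?mu ?s ! k = lam j" "map ?mu ?s ! l = lam j"
    using k l I assms by (auto simp del: sorted_list_of_set_insert_remove)
  then have "col (coord_matrix bs (map ?mu ?s)) k = col (coord_matrix bs (map ?mu ?s)) l"
    using k l I unfolding coord_matrix_def
    by (intro eq_vecI) (auto simp del: sorted_list_of_set_insert_remove)
  ultimately have "Determinant.det (coord_matrix bs (map ?mu ?s)) = 0"
    using k l I
    by (intro Determinant.det_identical_columns[of _ "length bs" k l])
      (auto simp: coord_matrix_def simp del: sorted_list_of_set_insert_remove)
  then have "cofactor_form bs ?mu (?I - {i}) (?mu i) = 0"
    using det_coord_matrix_sorted[OF I k(1), of ?mu] k(2) by simp
  moreover have "?I - {i} = F" using assms by auto
  moreover have "cofactor_form bs ?mu F = cofactor_form bs lam F"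
    using assms by (intro cofactor_form_cong) auto
  ultimately show ?thesis by simp
qed

text \<open>The entries of a kernel vector are the coefficients of a linear relation between the
  vectors of \<open>I\<close>, since the combination \<open>x\<close> they define has zero
  coordinates with respect to \<open>bs\<close>.\<close>

lemma det_coord_matrix_basis:
  fixes lam :: "nat \<Rightarrow> 'a::euclidean_space"
  assumes bs: "ordered_basis bs" and bas: "is_basis lam I"
  shows "Determinant.det (coord_matrix bs (map lam (sorted_list_of_set I))) \<noteq> 0"
proof
  let ?s = "sorted_list_of_set I" and ?n = "length bs"
  let ?A = "coord_matrix bs (map lam ?s)"
  have ind: "independent (set bs)" and span: "span (set bs) = UNIV" and dist: "distinct bs"
    using bs by (auto simp: ordered_basis_def)
  have fin: "finite I" by (rule is_basis_finite[OF bas])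
  have "?n = DIM('a)"
    using dist dim_span_eq_card_independent[OF ind] span by (simp add: distinct_card)
  then have len: "length ?s = ?n" using is_basis_card[OF bas] by simp
  assume "Determinant.det ?A = 0"
  moreover have "?A \<in> carrier_mat ?n ?n" by (simp add: coord_matrix_def)
  ultimately obtain v where v: "v \<in> carrier_vec ?n" "v \<noteq> 0\<^sub>v ?n" "?A *\<^sub>v v = 0\<^sub>v ?n"
    using det_0_iff_vec_prod_zero by blast
  define x where "x = (\<Sum>j<?n. vec_index v j *\<^sub>R lam (?s ! j))"
  have "representation (set bs) x (bs ! r) = 0" if "r < ?n" for r
  proof -
    have lin: "linear (\<lambda>v. representation (set bs) v (bs ! r))"
      by (rule linear_representation[OF ind span])
    have "representation (set bs) x (bs ! r) = (\<Sum>j<?n. vec_index v j * representation (set bs) (lam (?s ! j)) (bs ! r))"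
      by (simp add: x_def linear_sum[OF lin] linear_scale[OF lin])
    also have "\<dots> = vec_index (?A *\<^sub>v v) r"
      using that v(1) len
      by (auto simp: coord_matrix_def scalar_prod_def mult.commute lessThan_atLeast0 intro!: sum.cong)
    also have "\<dots> = 0" using v(3) that by simp
    finally show ?thesis .
  qed
  then have "representation (set bs) x b = 0" if "b \<in> set bs" for b
    using that by (metis in_set_conv_nth)
  then have "x = 0"
    using sum_representation_eq[OF ind, of x "set bs"] span by simp
  have bij: "bij_betw ((!) ?s) {..<?n} I"
    by (rule bij_betw_nth) (use fin len in auto)
  let ?pos = "the_inv_into {..<?n} ((!) ?s)"
  have "x = (\<Sum>j<?n. vec_index v (?pos (?s ! j)) *\<^sub>R lam (?s ! j))"
    unfolding x_def using bij by (intro sum.cong refl) (auto simp: bij_betw_def the_inv_into_f_f)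
  also have "\<dots> = (\<Sum>i\<in>I. vec_index v (?pos i) *\<^sub>R lam i)"
    by (rule sum.reindex_bij_betw[OF bij])
  finally have "(\<Sum>i\<in>I. vec_index v (?pos i) *\<^sub>R lam i) = 0" using \<open>x = 0\<close> by simp
  from is_basis_sum_eq_0[OF bas this] have zero: "vec_index v (?pos i) = 0" if "i \<in> I" for i
    using that .
  have "vec_index v j = 0" if "j < ?n" for j
  proof -
    have "?s ! j \<in> I" "?pos (?s ! j) = j"
      using bij that by (auto simp: bij_betw_def the_inv_into_f_f)
    then show ?thesis using zero by metis
  qed
  then show False using v(1,2) by (auto intro: eq_vecI)
qed

text \<open>The boundary sign cancels the sign of the expansion. What remains is the sign of one
  linear form attached to the facet, evaluated at the removed vertex, without reference to the
  position \<open>k\<close>.\<close>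

lemma orient_sign_cofactor:
  fixes lam :: "nat \<Rightarrow> 'a::euclidean_space"
  assumes bs: "ordered_basis bs" and bas: "is_basis lam I" and k: "k < card I"
  shows "(-1) ^ k * orient_sign bs lam I
    = sgn (cofactor_form bs lam (I - {sorted_list_of_set I ! k}) (lam (sorted_list_of_set I ! k)))"
proof -
  let ?s = "sorted_list_of_set I"
  have fin: "finite I" by (rule is_basis_finite[OF bas])
  have "length bs = DIM('a)"
    using bs dim_span_eq_card_independent[of "set bs"] by (simp add: ordered_basis_def distinct_card)
  then have len: "card I = length bs" using is_basis_card[OF bas] by simp
  have "ordered_basis (map lam ?s)"
    using bas fin by (simp add: ordered_basis_def is_basis_def distinct_map)
  then have "orient_sign bs lam I = sgn (Determinant.det (coord_matrix bs (map lam ?s)))"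
    using det_coord_matrix_basis[OF bs bas]
    by (simp add: orient_sign_def positive_basis_def coord_matrix_def sgn_if)
  also have "\<dots> = (-1) ^ k * sgn (cofactor_form bs lam (I - {?s ! k}) (lam (?s ! k)))"
    using det_coord_matrix_sorted[OF fin len k, of lam] by (cases "even k") (simp_all add: sgn_mult)
  finally show ?thesis by (simp add: power_mult_distrib[symmetric] flip: mult.assoc power_add)
qed

lemma cofactor_form_basis:
  fixes lam :: "nat \<Rightarrow> 'a::euclidean_space"
  assumes bs: "ordered_basis bs" and bas: "is_basis lam (insert i F)" and i: "i \<notin> F"
  shows "cofactor_form bs lam F (lam i) \<noteq> 0"
proof -
  have fin: "finite (insert i F)" by (rule is_basis_finite[OF bas])
  have "length bs = DIM('a)"
    using bs dim_span_eq_card_independent[of "set bs"] by (simp add: ordered_basis_def distinct_card)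
  then have len: "card (insert i F) = length bs" using is_basis_card[OF bas] by simp
  obtain k where k: "k < card (insert i F)" "sorted_list_of_set (insert i F) ! k = i"
    by (rule nth_sorted_list_of_set[OF fin, of i]) auto
  show ?thesis
    using det_coord_matrix_basis[OF bs bas] det_coord_matrix_sorted[OF fin len k(1), of lam] i k(2)
    by auto
qed

text \<open>The boundary runs over positions in sorted lists; these are turned into vertices, and
  the pairs of a simplex and a vertex whose removal leaves \<open>F\<close> are exactly the cofacets
  of \<open>F\<close>.\<close>

lemma lookup_boundary_underlying_chain:
  fixes lam :: "nat \<Rightarrow> 'a::euclidean_space"
  assumes bs: "ordered_basis bs" and fan: "multifan m w lam"
  shows "Poly_Mapping.lookup (boundary (underlying_chain bs m w lam)) F =
    (if F \<subseteq> {1..m} \<and> card F = DIM('a) - 1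
     then \<Sum>i\<in>cofacets m w F. w (insert i F) * sgn (cofactor_form bs lam F (lam i)) else 0)"
proof -
  let ?M = "max_simplices {1..m} DIM('a) w" and ?c = "underlying_chain bs m w lam"
  have finM: "finite ?M" by (simp add: finite_max_simplices)
  have look: "Poly_Mapping.lookup ?c I = (if I \<in> ?M then w I * orient_sign bs lam I else 0)" for I
    using finM by (simp add: underlying_chain_def lookup_sum lookup_single when_def)
  \<comment> \<open>Orientation signs are never 0, so no simplex is lost from the support of the
    chain.\<close>
  have "w I * orient_sign bs lam I \<noteq> 0" if "I \<in> ?M" for I
    using that by (simp add: orient_sign_def max_simplices_def)
  then have keys: "Poly_Mapping.keys ?c = ?M"
    by (simp add: set_eq_iff in_keys_iff look)
  have inner: "(\<Sum>k<card I. if I - {sorted_list_of_set I ! k} = F then (-1) ^ k * (w I * orient_sign bs lam I) else 0)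
      = (\<Sum>i\<in>I. if I - {i} = F then w I * sgn (cofactor_form bs lam F (lam i)) else 0)" if I: "I \<in> ?M" for I
  proof -
    let ?s = "sorted_list_of_set I"
    have bas: "is_basis lam I" using multifan_is_basis[OF fan I] .
    have fin: "finite I" by (rule is_basis_finite[OF bas])
    have bij: "bij_betw ((!) ?s) {..<card I} I"
      by (rule bij_betw_nth) (use fin in auto)
    have "(\<Sum>k<card I. if I - {?s ! k} = F then (-1) ^ k * (w I * orient_sign bs lam I) else 0)
      = (\<Sum>k<card I. if I - {?s ! k} = F then w I * sgn (cofactor_form bs lam F (lam (?s ! k))) else 0)"
      using orient_sign_cofactor[OF bs bas] by (intro sum.cong refl) (auto simp: mult_ac)
    also have "\<dots> = (\<Sum>i\<in>I. if I - {i} = F then w I * sgn (cofactor_form bs lam F (lam i)) else 0)"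
      by (rule sum.reindex_bij_betw[OF bij])
    finally show ?thesis .
  qed
  have "Poly_Mapping.lookup (boundary ?c) F = (\<Sum>I\<in>?M. \<Sum>k<card I.
      if I - {sorted_list_of_set I ! k} = F then (-1) ^ k * (w I * orient_sign bs lam I) else 0)"
    unfolding boundary_def keys
    by (auto simp: lookup_sum lookup_single when_def look intro!: sum.cong)
  also have "\<dots> = (\<Sum>I\<in>?M. \<Sum>i\<in>I. if I - {i} = F then w I * sgn (cofactor_form bs lam F (lam i)) else 0)"
    by (rule sum.cong[OF refl inner])
  also have "\<dots> = (\<Sum>(I, i)\<in>(SIGMA I:?M. I). if I - {i} = F then w I * sgn (cofactor_form bs lam F (lam i)) else 0)"
    by (rule sum.Sigma[OF finM]) (blast intro: is_basis_finite multifan_is_basis[OF fan])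
  also have "\<dots> = (if F \<subseteq> {1..m} \<and> card F = DIM('a) - 1
     then \<Sum>i\<in>cofacets m w F. w (insert i F) * sgn (cofactor_form bs lam F (lam i)) else 0)"
  proof (cases "F \<subseteq> {1..m} \<and> card F = DIM('a) - 1")
    case True
    then have finF: "finite F" using finite_subset by blast
    have inj: "inj_on (\<lambda>i. (insert i F, i)) (cofacets m w F)" by (auto simp: inj_on_def)
    have im: "(insert i F, i) \<in> (SIGMA I:?M. I)" if "i \<in> cofacets m w F" for i
      using that True finF by (auto simp: cofacets_def max_simplices_def)
    have "(\<Sum>(I, i)\<in>(SIGMA I:?M. I). if I - {i} = F then w I * sgn (cofactor_form bs lam F (lam i)) else 0)
      = (\<Sum>(I, i)\<in>(\<lambda>i. (insert i F, i)) ` cofacets m w F. if I - {i} = F then w I * sgn (cofactor_form bs lam F (lam i)) else 0)"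
    proof (rule sum.mono_neutral_right)
      show "finite (SIGMA I:?M. I)"
        by (rule finite_SigmaI[OF finM]) (blast intro: is_basis_finite multifan_is_basis[OF fan])
      show "\<forall>x\<in>(SIGMA I:?M. I) - (\<lambda>i. (insert i F, i)) ` cofacets m w F.
        (case x of (I, i) \<Rightarrow> if I - {i} = F then w I * sgn (cofactor_form bs lam F (lam i)) else 0) = 0"
      proof
        fix x assume x: "x \<in> (SIGMA I:?M. I) - (\<lambda>i. (insert i F, i)) ` cofacets m w F"
        then obtain I i where I: "x = (I, i)" "I \<in> ?M" "i \<in> I" by blast
        have "I - {i} \<noteq> F"
        proof
          assume "I - {i} = F"
          then have "I = insert i F" "i \<in> cofacets m w F"
            using I by (auto simp: cofacets_def max_simplices_def insert_absorb)
          then show False using x I(1) by blast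
        qed
        then show "(case x of (I, i) \<Rightarrow> if I - {i} = F then w I * sgn (cofactor_form bs lam F (lam i)) else 0) = 0"
          by (simp add: I(1))
      qed
    qed (use im in auto)
    also have "\<dots> = (\<Sum>i\<in>cofacets m w F. w (insert i F) * sgn (cofactor_form bs lam F (lam i)))"
      using inj by (auto simp: sum.reindex cofacets_def intro!: sum.cong)
    finally show ?thesis using True by simp
  next
    case False
    have "I - {i} \<noteq> F" if "I \<in> ?M" "i \<in> I" for I i
      using that False by (auto simp: max_simplices_def card_Diff_singleton)
    then show ?thesis using False by (intro sum.neutral[THEN trans]) auto
  qed
  finally show ?thesis .
qed

text \<open>For \<open>F\<close> with a cofacet, the cofactor form is the inner product with a
  nonzero normal \<open>g\<close> of \<open>F\<close>. Any other normal is a multiple of it, which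
  changes the sum by the sign of the factor. Without cofacets both sums are empty.\<close>

lemma closed_chain_iff_wall_balanced:
  fixes lam :: "nat \<Rightarrow> 'a::euclidean_space"
  assumes bs: "ordered_basis bs" and fan: "multifan m w lam"
  shows "closed_chain (underlying_chain bs m w lam) \<longleftrightarrow> wall_balanced m w lam"
proof -
  have len: "length bs = DIM('a)"
    using bs dim_span_eq_card_independent[of "set bs"] by (simp add: ordered_basis_def distinct_card)
  let ?sum = "\<lambda>F. \<Sum>i\<in>cofacets m w F. w (insert i F) * sgn (cofactor_form bs lam F (lam i))"
  have normal: "\<exists>g. g \<noteq> 0 \<and> F \<in> walls m lam g \<and> (\<forall>v. cofactor_form bs lam F v = g \<bullet> v)"
    if F: "F \<subseteq> {1..m}" "card F = DIM('a) - 1" and i: "i \<in> cofacets m w F" for F i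
  proof -
    have fin: "finite F" using F finite_subset by blast
    have "insert i F \<in> max_simplices {1..m} DIM('a) w"
      using F i fin by (auto simp: cofacets_def max_simplices_def)
    then have bas: "is_basis lam (insert i F)" by (rule multifan_is_basis[OF fan])
    have lin: "linear (cofactor_form bs lam F)" by (rule linear_cofactor_form[OF bs])
    define g where "g = adjoint (cofactor_form bs lam F) 1"
    have g: "cofactor_form bs lam F v = g \<bullet> v" for v
      using adjoint_works[OF lin, of v 1] by (simp add: g_def inner_commute)
    have "g \<bullet> lam j = 0" if "j \<in> F" for j
      using cofactor_form_eq_0[OF bs fin _ that cofacet_notin[OF i], of lam] F len by (simp add: g)
    then have "F \<in> walls m lam g" using F by (simp add: walls_def)
    moreover have "g \<noteq> 0"
      using cofactor_form_basis[OF bs bas cofacet_notin[OF i]] g by auto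
    ultimately show ?thesis using g by blast
  qed
  have "closed_chain (underlying_chain bs m w lam) \<longleftrightarrow>
      (\<forall>F. Poly_Mapping.lookup (boundary (underlying_chain bs m w lam)) F = 0)"
    by (simp add: closed_chain_def poly_mapping_eq_iff fun_eq_iff)
  also have "\<dots> \<longleftrightarrow> (\<forall>F. F \<subseteq> {1..m} \<longrightarrow> card F = DIM('a) - 1 \<longrightarrow> ?sum F = 0)"
    unfolding lookup_boundary_underlying_chain[OF bs fan] by auto
  also have "\<dots> \<longleftrightarrow> wall_balanced m w lam"
  proof
    assume L: "\<forall>F. F \<subseteq> {1..m} \<longrightarrow> card F = DIM('a) - 1 \<longrightarrow> ?sum F = 0"
    show "wall_balanced m w lam"
      unfolding wall_balanced_def
    proof (intro allI impI)
      fix e F assume e: "e \<noteq> 0" and F: "F \<in> walls m lam e"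
      show "(\<Sum>i\<in>cofacets m w F. w (insert i F) * sgn (e \<bullet> lam i)) = 0"
      proof (cases "cofacets m w F = {}")
        case False
        then obtain i where i: "i \<in> cofacets m w F" by blast
        have bas: "is_basis lam (insert i F)"
          using multifan_is_basis[OF fan cofacet_max_simplex[OF F i]] .
        obtain g where g: "g \<noteq> 0" "F \<in> walls m lam g" "\<And>v. cofactor_form bs lam F v = g \<bullet> v"
          using normal[OF _ _ i] F by (auto simp: walls_def)
        define c where "c = (g \<bullet> lam i) / (e \<bullet> lam i)"
        have gc: "g = c *\<^sub>R e"
          unfolding c_def using F g(2) e
          by (intro normal_parallel[OF bas cofacet_notin[OF i]]) (auto simp: walls_def)
        then have "c \<noteq> 0" using g(1) by auto
        have "?sum F = 0" using L F unfolding walls_def by blast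
        then have "0 = (\<Sum>i\<in>cofacets m w F. w (insert i F) * sgn (g \<bullet> lam i))"
          unfolding g(3) by simp
        also have "\<dots> = sgn c * (\<Sum>i\<in>cofacets m w F. w (insert i F) * sgn (e \<bullet> lam i))"
          by (simp add: gc sgn_mult sum_distrib_left mult_ac)
        finally show ?thesis using \<open>c \<noteq> 0\<close> by (simp add: sgn_zero_iff)
      qed simp
    qed
  next
    assume R: "wall_balanced m w lam"
    show "\<forall>F. F \<subseteq> {1..m} \<longrightarrow> card F = DIM('a) - 1 \<longrightarrow> ?sum F = 0"
    proof (intro allI impI)
      fix F assume F: "F \<subseteq> {1..m}" "card F = DIM('a) - 1"
      show "?sum F = 0"
      proof (cases "cofacets m w F = {}")
        case False
        then obtain i where i: "i \<in> cofacets m w F" by blast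
        obtain g where "g \<noteq> 0" "F \<in> walls m lam g" "\<And>v. cofactor_form bs lam F v = g \<bullet> v"
          using normal[OF F i] by blast
        then show ?thesis using R by (simp add: wall_balanced_def)
      qed simp
    qed
  qed
  finally show ?thesis .
qed

section \<open>Completeness and wall crossing\<close>

lemma coset_eq_iff:
  assumes "subspace U"
  shows "coset U x = coset U y \<longleftrightarrow> x - y \<in> U"
proof
  assume "coset U x = coset U y"
  moreover have "x + 0 \<in> coset U x"
    unfolding coset_def using subspace_0[OF assms] by blast
  ultimately show "x - y \<in> U" by (auto simp: coset_def)
next
  have sub: "coset U x \<subseteq> coset U y" if xy: "x - y \<in> U" for x y
  proof
    fix z assume "z \<in> coset U x"
    then obtain u where u: "u \<in> U" "z = x + u" by (auto simp: coset_def)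
    then have "z = y + ((x - y) + u)" "(x - y) + u \<in> U" using subspace_add[OF assms xy] by auto
    then show "z \<in> coset U y" unfolding coset_def by blast
  qed
  assume "x - y \<in> U"
  moreover from subspace_neg[OF assms this] have "y - x \<in> U" by simp
  ultimately show "coset U x = coset U y" using sub by blast
qed

lemma dual_vector_span:
  assumes "is_basis lam I" "J \<subseteq> I" "i \<in> I - J" "v \<in> span (lam ` J)"
  shows "dual_vector lam I i \<bullet> v = 0"
  using assms(4)
proof (induction rule: span_induct)
  case base
  show ?case by (auto simp: subspace_def inner_add_right)
next
  case (step v)
  then show ?case using dual_vector_inner[OF assms(1)] assms(2,3) by auto
qed

lemma dual_vector_remainder:
  assumes "is_basis lam I" "J \<subseteq> I"
  shows "x - (\<Sum>i\<in>I - J. (dual_vector lam I i \<bullet> x) *\<^sub>R lam i) \<in> span (lam ` J)"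
proof -
  have fin: "finite I" by (rule is_basis_finite[OF assms(1)])
  have "x = (\<Sum>i\<in>I. (dual_vector lam I i \<bullet> x) *\<^sub>R lam i)"
    by (rule dual_vector_expansion[OF assms(1), symmetric])
  also have "\<dots> = (\<Sum>i\<in>I - J. (dual_vector lam I i \<bullet> x) *\<^sub>R lam i) + (\<Sum>i\<in>J. (dual_vector lam I i \<bullet> x) *\<^sub>R lam i)"
    by (rule sum.subset_diff[OF assms(2) fin])
  finally have "x - (\<Sum>i\<in>I - J. (dual_vector lam I i \<bullet> x) *\<^sub>R lam i) = (\<Sum>i\<in>J. (dual_vector lam I i \<bullet> x) *\<^sub>R lam i)"
    by (simp add: algebra_simps)
  also have "\<dots> \<in> span (lam ` J)"
    by (intro span_sum span_scale span_base) auto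
  finally show ?thesis .
qed

text \<open>For \<open>i\<close> outside \<open>J\<close> the dual vector vanishes on the span of
  \<open>J\<close>, so it is a coordinate function on the quotient.\<close>

lemma quotient_cone_iff:
  assumes "is_basis lam I" "J \<subseteq> I"
  shows "coset (span (lam ` J)) x \<in> quotient_cone (span (lam ` J)) lam (I - J)
    \<longleftrightarrow> (\<forall>i\<in>I - J. 0 \<le> dual_vector lam I i \<bullet> x)"
proof
  assume "coset (span (lam ` J)) x \<in> quotient_cone (span (lam ` J)) lam (I - J)"
  then obtain r where r: "coset (span (lam ` J)) x = coset (span (lam ` J)) (\<Sum>i\<in>I - J. r i *\<^sub>R lam i)"
    "\<forall>i\<in>I - J. 0 \<le> r i"
    unfolding quotient_cone_def by blast
  have mem: "x - (\<Sum>i\<in>I - J. r i *\<^sub>R lam i) \<in> span (lam ` J)"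
    using r(1) coset_eq_iff subspace_span by blast
  show "\<forall>i\<in>I - J. 0 \<le> dual_vector lam I i \<bullet> x"
  proof
    fix i assume i: "i \<in> I - J"
    have "dual_vector lam I i \<bullet> x = dual_vector lam I i \<bullet> (\<Sum>k\<in>I - J. r k *\<^sub>R lam k)"
      using dual_vector_span[OF assms i mem] by (simp add: inner_diff_right)
    also have "\<dots> = (\<Sum>k\<in>I - J. if k = i then r k else 0)"
      unfolding inner_sum_right
      by (intro sum.cong refl) (auto simp: dual_vector_inner[OF assms(1)])
    also have "\<dots> = r i" using i is_basis_finite[OF assms(1)] by simp
    finally show "0 \<le> dual_vector lam I i \<bullet> x" using r(2) i by simp
  qed
next
  assume "\<forall>i\<in>I - J. 0 \<le> dual_vector lam I i \<bullet> x"
  moreover have "coset (span (lam ` J)) x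
      = coset (span (lam ` J)) (\<Sum>i\<in>I - J. (dual_vector lam I i \<bullet> x) *\<^sub>R lam i)"
    using dual_vector_remainder[OF assms] coset_eq_iff subspace_span by blast
  ultimately show "coset (span (lam ` J)) x \<in> quotient_cone (span (lam ` J)) lam (I - J)"
    unfolding quotient_cone_def by (intro CollectI exI[of _ "\<lambda>i. dual_vector lam I i \<bullet> x"] conjI)
qed

lemma quotient_span_mem:
  assumes "is_basis lam I" "J \<subseteq> I" "i \<in> I - J" "dual_vector lam I i \<bullet> x = 0"
  shows "coset (span (lam ` J)) x \<in> quotient_span (span (lam ` J)) lam (I - J - {i})"
proof -
  have "(\<Sum>k\<in>I - J. (dual_vector lam I k \<bullet> x) *\<^sub>R lam k) = (\<Sum>k\<in>I - J - {i}. (dual_vector lam I k \<bullet> x) *\<^sub>R lam k)"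
    using is_basis_finite[OF assms(1)] assms(3,4) by (subst sum.remove[of _ i]) auto
  then have "coset (span (lam ` J)) x
      = coset (span (lam ` J)) (\<Sum>k\<in>I - J - {i}. (dual_vector lam I k \<bullet> x) *\<^sub>R lam k)"
    using dual_vector_remainder[OF assms(1,2)] coset_eq_iff subspace_span by metis
  then show ?thesis
    unfolding quotient_span_def by (intro CollectI exI[of _ "\<lambda>i. dual_vector lam I i \<bullet> x"] conjI TrueI)
qed

text \<open>The quotient by the span of \<open>F\<close> is a line, and the classes of
  \<open>e\<close> and \<open>-e\<close> lie on its two rays. Their multiplicities add the weights
  of the cofacets on either side of the wall; the difference is the balancing sum.\<close>

lemma complete_imp_wall_balanced:
  fixes lam :: "nat \<Rightarrow> 'a::euclidean_space"
  assumes fan: "multifan m w lam" and complete: "complete_multifan m w lam"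
  shows "wall_balanced m w lam"
  unfolding wall_balanced_def
proof (intro allI impI)
  fix e :: 'a and F assume e: "e \<noteq> 0" and F: "F \<in> walls m lam e"
  let ?C = "cofacets m w F"
  show "(\<Sum>i\<in>?C. w (insert i F) * sgn (e \<bullet> lam i)) = 0"
  \<comment> \<open>A wall without cofacets is not a face, so completeness says nothing about it,
    but its sum is empty.\<close>
  proof (cases "?C = {}")
    case False
    let ?U = "span (lam ` F)" and ?A = "{1..m} - F" and ?w = "\<lambda>J. w (F \<union> J)"
    have bas: "is_basis lam (insert i F)" if "i \<in> ?C" for i
      using multifan_is_basis[OF fan cofacet_max_simplex[OF F that]] .
    have orth: "e \<bullet> lam j = 0" if "j \<in> F" for j using F that by (simp add: walls_def)
    have ei: "e \<bullet> lam i \<noteq> 0" if "i \<in> ?C" for i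
      using is_basis_normal_inner[OF bas[OF that] orth e] .
    have card: "DIM('a) - card F = 1" using F by (simp add: walls_def Suc_leI)
    have "F \<in> faces {1..m} DIM('a) w"
      using False cofacet_max_simplex[OF F] unfolding faces_def by blast
    then have pre: "pre_complete ?A 1 ?w ?U lam"
      using complete card unfolding complete_multifan_def by metis
    have maxs: "max_simplices ?A 1 ?w = (\<lambda>i. {i}) ` ?C"
      by (auto simp: max_simplices_def cofacets_def card_1_singleton_iff)
    have eU: "c *\<^sub>R e \<notin> ?U" if "c \<noteq> 0" for c
    proof
      assume "c *\<^sub>R e \<in> ?U"
      then have "e \<bullet> (c *\<^sub>R e) = 0"
      proof (induction rule: span_induct)
        case base
        show ?case by (auto simp: subspace_def inner_add_right)
      qed (auto simp: orth)
      then show False using that e by simp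
    qed
    \<comment> \<open>In dimension 1 only the empty face counts, so generic means having a nonzero
      class.\<close>
    have gen: "generic ?A 1 ?w ?U lam (coset ?U (c *\<^sub>R e))" if "c \<noteq> 0" for c
      unfolding generic_def
    proof (intro conjI ballI impI)
      fix G assume "G \<in> faces ?A 1 ?w" "card G < 1"
      then obtain i where "G \<subseteq> {i}" "card G = 0" unfolding faces_def maxs by auto
      then have "G = {}" using finite_subset[of G "{i}"] by simp
      then show "coset ?U (c *\<^sub>R e) \<notin> quotient_span ?U lam G"
        using eU[OF that] coset_eq_iff[OF subspace_span, of _ "c *\<^sub>R e" 0] by (simp add: quotient_span_def)
    qed simp
    have sign: "0 \<le> c * q / a \<longleftrightarrow> 0 < c * a" if "0 < q" "c \<noteq> 0" "a \<noteq> 0" for c q a :: real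
      using that by (auto simp: zero_le_divide_iff zero_less_mult_iff zero_le_mult_iff mult_le_0_iff)
    have cone: "coset ?U (c *\<^sub>R e) \<in> quotient_cone ?U lam {i} \<longleftrightarrow> 0 < c * (e \<bullet> lam i)"
      if i: "i \<in> ?C" and c: "c \<noteq> 0" for c i
    proof -
      have "insert i F - F = {i}" using cofacet_notin[OF i] by auto
      then have "coset ?U (c *\<^sub>R e) \<in> quotient_cone ?U lam {i} \<longleftrightarrow> 0 \<le> dual_vector lam (insert i F) i \<bullet> (c *\<^sub>R e)"
        using quotient_cone_iff[OF bas[OF i], of F "c *\<^sub>R e"] by auto
      also have "\<dots> \<longleftrightarrow> 0 \<le> c * (e \<bullet> e) / (e \<bullet> lam i)"
        using dual_vector_normal[OF bas[OF i] cofacet_notin[OF i] orth e] by simp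
      also have "\<dots> \<longleftrightarrow> 0 < c * (e \<bullet> lam i)"
        using sign[of "e \<bullet> e" c "e \<bullet> lam i"] ei[OF i] e c by simp
      finally show ?thesis .
    qed
    have mult: "multiplicity_at ?A 1 ?w ?U lam (coset ?U (c *\<^sub>R e))
        = (\<Sum>i\<in>?C. if 0 < c * (e \<bullet> lam i) then w (insert i F) else 0)" if "c \<noteq> 0" for c
    proof -
      have "{I. I \<in> max_simplices ?A 1 ?w \<and> coset ?U (c *\<^sub>R e) \<in> quotient_cone ?U lam I}
          = (\<lambda>i. {i}) ` {i \<in> ?C. 0 < c * (e \<bullet> lam i)}"
        unfolding maxs using cone[OF _ that] by auto
      then have "multiplicity_at ?A 1 ?w ?U lam (coset ?U (c *\<^sub>R e))
        = (\<Sum>i\<in>{i \<in> ?C. 0 < c * (e \<bullet> lam i)}. w (insert i F))"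
        unfolding multiplicity_at_def by (simp add: sum.reindex)
      then show ?thesis by (simp add: sum.inter_filter finite_cofacets)
    qed
    have "generic ?A 1 ?w ?U lam (coset ?U (1 *\<^sub>R e))" "generic ?A 1 ?w ?U lam (coset ?U ((-1) *\<^sub>R e))"
      by (rule gen, simp)+
    then have "multiplicity_at ?A 1 ?w ?U lam (coset ?U (1 *\<^sub>R e)) = multiplicity_at ?A 1 ?w ?U lam (coset ?U ((-1) *\<^sub>R e))"
      using pre unfolding pre_complete_def by blast
    then have eq: "(\<Sum>i\<in>?C. if 0 < e \<bullet> lam i then w (insert i F) else 0)
        = (\<Sum>i\<in>?C. if e \<bullet> lam i < 0 then w (insert i F) else 0)"
      using mult[of 1] mult[of "-1"] by simp
    have "(\<Sum>i\<in>?C. w (insert i F) * sgn (e \<bullet> lam i)) =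
      (\<Sum>i\<in>?C. (if 0 < e \<bullet> lam i then w (insert i F) else 0) - (if e \<bullet> lam i < 0 then w (insert i F) else 0))"
      by (intro sum.cong refl) (auto simp: sgn_if)
    also have "\<dots> = 0" using eq by (simp add: sum_subtractf)
    finally show ?thesis .
  qed simp
qed

section \<open>Perturbing points off hyperplanes\<close>

lemma eventually_sgn_inner_nhds:
  fixes u p :: "'a::euclidean_space"
  assumes "u \<bullet> p \<noteq> 0"
  shows "eventually (\<lambda>z. sgn (u \<bullet> z) = sgn (u \<bullet> p)) (nhds p)"
proof -
  have lim: "((\<lambda>z. u \<bullet> z) \<longlongrightarrow> u \<bullet> p) (nhds p)"
    by (intro tendsto_intros) (simp add: filterlim_ident)
  show ?thesis
  proof (cases "u \<bullet> p > 0")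
    case True
    then show ?thesis using order_tendstoD(1)[OF lim True] by (auto elim: eventually_mono)
  next
    case False
    then have "u \<bullet> p < 0" using assms by simp
    then show ?thesis using order_tendstoD(2)[OF lim, of 0] by (auto elim: eventually_mono)
  qed
qed

lemma eventually_inner_nonzero:
  fixes c y z :: "'a::euclidean_space"
  assumes "c \<bullet> y \<noteq> 0 \<or> c \<bullet> z \<noteq> 0"
  shows "eventually (\<lambda>s. c \<bullet> (y + s *\<^sub>R z) \<noteq> 0) (at_right (0::real))"
proof (cases "c \<bullet> y = 0")
  case True
  then have "c \<bullet> (y + s *\<^sub>R z) \<noteq> 0" if "s > 0" for s
    using assms that by (simp add: inner_add_right)
  then show ?thesis by (simp add: eventually_at_filter)
next
  case False
  have "((\<lambda>s. c \<bullet> (y + s *\<^sub>R z)) \<longlongrightarrow> c \<bullet> (y + 0 *\<^sub>R z)) (at_right (0::real))"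
    by (intro tendsto_intros)
  then show ?thesis using False by (intro tendsto_imp_eventually_ne) auto
qed

text \<open>A direction good for \<open>Z\<close> is moved slightly along the new normal
  \<open>a\<close>, whose inner product with itself is nonzero; small moves keep the old
  conditions.\<close>

lemma exists_generic_direction:
  fixes Z :: "'a::euclidean_space set"
  assumes "finite Z" "0 \<notin> Z"
  shows "\<exists>z. \<forall>c\<in>Z. c \<bullet> z \<noteq> 0"
  using assms
proof (induction Z rule: finite_induct)
  case (insert a Z)
  then obtain z where z: "\<forall>c\<in>Z. c \<bullet> z \<noteq> 0" by auto
  have "eventually (\<lambda>s. c \<bullet> (z + s *\<^sub>R a) \<noteq> 0) (at_right 0)" if "c \<in> insert a Z" for c
    using that z insert.prems by (intro eventually_inner_nonzero) auto
  then have "eventually (\<lambda>s. \<forall>c\<in>insert a Z. c \<bullet> (z + s *\<^sub>R a) \<noteq> 0) (at_right 0)"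
    using insert.hyps by (intro eventually_ball_finite) auto
  from eventually_happens'[OF _ this] show ?case by (auto simp: trivial_limit_at_right_real)
qed simp

text \<open>
  The multiplicity function of the projection along \<open>J\<close>, with the indicator of a half-space
  replaced by 1/2 on its boundary. With this normalisation it is locally constant even at a point
  that lies on a single wall.
\<close>

definition smoothed_multiplicity ::
  "nat \<Rightarrow> (nat set \<Rightarrow> real) \<Rightarrow> (nat \<Rightarrow> 'a::euclidean_space) \<Rightarrow> nat set \<Rightarrow> 'a \<Rightarrow> real" where
  "smoothed_multiplicity m w lam J x = (\<Sum>I\<in>max_simplices {1..m} DIM('a) w.
     if J \<subseteq> I then w I * (\<Prod>i\<in>I - J. (1 + sgn (dual_vector lam I i \<bullet> x)) / 2) else 0)"

text \<open>The wall hyperplanes of the fan projected along \<open>J\<close>, lifted to the whole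
  space: these vectors are orthogonal to the vectors of \<open>J\<close>.\<close>

definition normals :: "nat \<Rightarrow> (nat set \<Rightarrow> real) \<Rightarrow> (nat \<Rightarrow> 'a::euclidean_space) \<Rightarrow> nat set \<Rightarrow> 'a set" where
  "normals m w lam J = {dual_vector lam I i | I i. I \<in> max_simplices {1..m} DIM('a) w \<and> J \<subseteq> I \<and> i \<in> I - J}"

lemma finite_normals: "finite (normals m w lam J)"
proof -
  let ?S = "SIGMA I:max_simplices {1..m} DIM('a) w. I"
  have "normals m w lam J \<subseteq> (\<lambda>(I, i). dual_vector lam I i) ` ?S"
    by (auto simp: normals_def)
  moreover have "finite ?S"
    by (intro finite_SigmaI finite_max_simplices) (auto simp: max_simplices_def intro: finite_subset)
  ultimately show ?thesis using finite_surj by blast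
qed

text \<open>The hypothesis on \<open>p\<close> says that it lies on at most one wall hyperplane.
  Simplices without a facet there contribute a locally constant amount. Around a wall
  \<open>F\<close> containing \<open>J\<close> the cofacet \<open>i\<close> contributes its weight
  times \<open>(1 + sgn (e \<bullet> z) * sgn (e \<bullet> lam i)) / 2\<close> times a factor common
  to all \<open>i\<close>, and balancing removes the part depending on \<open>z\<close>.\<close>

lemma smoothed_multiplicity_locally_constant:
  fixes lam :: "nat \<Rightarrow> 'a::euclidean_space" and p :: 'a
  assumes fan: "multifan m w lam" and bal: "wall_balanced m w lam"
    and p: "\<And>e u. e \<in> normals m w lam J \<Longrightarrow> u \<in> normals m w lam J \<Longrightarrow> e \<bullet> p = 0 \<Longrightarrow> u \<bullet> p = 0 \<Longrightarrow>
      \<exists>c. u = c *\<^sub>R e"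
  shows "eventually (\<lambda>z. smoothed_multiplicity m w lam J z = smoothed_multiplicity m w lam J p) (nhds p)"
proof -
  let ?M = "max_simplices {1..m} DIM('a) w" and ?N = "normals m w lam J"
  define f where "f z I = (if J \<subseteq> I then w I * (\<Prod>i\<in>I - J. (1 + sgn (dual_vector lam I i \<bullet> z)) / 2) else 0)" for z I
  have sm: "smoothed_multiplicity m w lam J z = (\<Sum>I\<in>?M. f z I)" for z
    by (simp add: smoothed_multiplicity_def f_def)
  have const: "eventually (\<lambda>z. f z I = f p I) (nhds p)"
    if I: "I \<in> ?M" and nz: "\<And>i. J \<subseteq> I \<Longrightarrow> i \<in> I - J \<Longrightarrow> dual_vector lam I i \<bullet> p \<noteq> 0" for I
  proof (cases "J \<subseteq> I")
    case True
    have "finite (I - J)" using is_basis_finite[OF multifan_is_basis[OF fan I]] by simp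
    then have "eventually (\<lambda>z. \<forall>i\<in>I - J. sgn (dual_vector lam I i \<bullet> z) = sgn (dual_vector lam I i \<bullet> p)) (nhds p)"
      using nz True by (intro eventually_ball_finite ballI eventually_sgn_inner_nhds) auto
    then show ?thesis by (rule eventually_mono) (simp add: f_def)
  qed (simp add: f_def)
  show ?thesis
  proof (cases "\<exists>e\<in>?N. e \<bullet> p = 0")
    case False
    have "eventually (\<lambda>z. \<forall>I\<in>?M. f z I = f p I) (nhds p)"
      using False by (intro eventually_ball_finite ballI const finite_max_simplices) (auto simp: normals_def)
    then show ?thesis by (rule eventually_mono) (simp add: sm)
  next
    case True
    then obtain e where eN: "e \<in> ?N" and ep: "e \<bullet> p = 0" by blast
    obtain I0 i0 where I0: "I0 \<in> ?M" "J \<subseteq> I0" "i0 \<in> I0 - J" "e = dual_vector lam I0 i0"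
      using eN unfolding normals_def by blast
    have bas0: "is_basis lam I0" by (rule multifan_is_basis[OF fan I0(1)])
    have e: "e \<noteq> 0" using I0 dual_vector_nonzero[OF bas0] by auto
    have eJ: "e \<bullet> lam j = 0" if "j \<in> J" for j
      using that I0 dual_vector_inner[OF bas0, of j i0] by auto
    let ?R = "{I \<in> ?M. \<forall>i\<in>I. I - {i} \<notin> walls m lam e}"
    have away: "eventually (\<lambda>z. f z I = f p I) (nhds p)" if I: "I \<in> ?R" for I
    proof (rule const)
      show "I \<in> ?M" using I by blast
      fix i assume i: "J \<subseteq> I" "i \<in> I - J"
      have bas: "is_basis lam I" using I multifan_is_basis[OF fan] by blast
      show "dual_vector lam I i \<bullet> p \<noteq> 0"
      proof
        assume "dual_vector lam I i \<bullet> p = 0"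
        moreover have "dual_vector lam I i \<in> ?N" using I i by (auto simp: normals_def)
        ultimately obtain c where c: "dual_vector lam I i = c *\<^sub>R e" using p[OF eN _ ep] by blast
        have "c \<noteq> 0" using c dual_vector_nonzero[OF bas, of i] i by auto
        have "e \<bullet> lam j = 0" if "j \<in> I - {i}" for j
        proof -
          have "c * (e \<bullet> lam j) = 0" using dual_vector_inner[OF bas, of j i] that c by auto
          then show ?thesis using \<open>c \<noteq> 0\<close> by simp
        qed
        then have "I - {i} \<in> walls m lam e"
          using I i is_basis_finite[OF bas] is_basis_card[OF bas] by (auto simp: walls_def max_simplices_def)
        then show False using I i by blast
      qed
    qed
    have wall: "\<exists>C. eventually (\<lambda>z. (\<Sum>i\<in>cofacets m w F. f z (insert i F)) = C) (nhds p)"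
      if F: "F \<in> walls m lam e" for F
    proof -
      let ?C = "cofacets m w F"
      have orth: "e \<bullet> lam j = 0" if "j \<in> F" for j using F that by (simp add: walls_def)
      have F': "finite F" "0 \<notin> F" using F wall_finite[OF F] by (auto simp: walls_def)
      have basi: "is_basis lam (insert i F)" if "i \<in> ?C" for i
        using multifan_is_basis[OF fan cofacet_max_simplex[OF F that]] .
      \<comment> \<open>The normal \<open>e\<close> vanishes on the vectors of \<open>J\<close>, but
        not on the vertex opposite to the wall.\<close>
      have notJ: "i \<notin> J" if "i \<in> ?C" for i
        using eJ is_basis_normal_inner[OF basi[OF that] orth e] by blast
      show ?thesis
      proof (cases "J \<subseteq> F")
        case False
        then have "f z (insert i F) = 0" if "i \<in> ?C" for z i
          using notJ[OF that] by (auto simp: f_def)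
        then show ?thesis by (intro exI[of _ 0]) simp
      next
        case True
        \<comment> \<open>The common factor. Since \<open>e \<bullet> p = 0\<close>, each remaining
          dual vector has the same value at \<open>p\<close> as its projection, which does not
          depend on the cofacet.\<close>
        define D where "D = (\<Prod>j\<in>F - J. (1 + sgn (dual_vector (lam(0 := e)) (insert 0 F) j \<bullet> p)) / 2)"
        have "eventually (\<lambda>z. f z (insert i F) = w (insert i F) * ((1 + sgn (e \<bullet> z) * sgn (e \<bullet> lam i)) / 2) * D) (nhds p)"
          if i: "i \<in> ?C" for i
        proof -
          let ?u = "dual_vector lam (insert i F)"
          have bas: "is_basis lam (insert i F)" by (rule basi[OF i])
          have up: "?u j \<bullet> p = dual_vector (lam(0 := e)) (insert 0 F) j \<bullet> p" if "j \<in> F - J" for j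
            using proj_dual_vector[OF bas cofacet_notin[OF i] F'(2) orth e, of j] that ep
            by (simp add: proj_def inner_diff_left)
          have "?u j \<bullet> p \<noteq> 0" if j: "j \<in> F - J" for j
          proof
            assume 0: "?u j \<bullet> p = 0"
            have "?u j \<in> ?N"
              using j True cofacet_max_simplex[OF F i] unfolding normals_def by blast
            then obtain c where "?u j = c *\<^sub>R e" using p[OF eN _ ep 0] by blast
            then have "?u j \<bullet> lam j = 0" using orth j by simp
            then show False using dual_vector_inner[OF bas, of j j] j by simp
          qed
          then have "eventually (\<lambda>z. \<forall>j\<in>F - J. sgn (?u j \<bullet> z) = sgn (?u j \<bullet> p)) (nhds p)"
            using F'(1) by (intro eventually_ball_finite ballI eventually_sgn_inner_nhds) auto
          then show ?thesis
          proof (rule eventually_mono)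
            fix z assume z: "\<forall>j\<in>F - J. sgn (?u j \<bullet> z) = sgn (?u j \<bullet> p)"
            have "insert i F - J = insert i (F - J)" using notJ[OF i] by auto
            then have "f z (insert i F) = w (insert i F) * ((1 + sgn (?u i \<bullet> z)) / 2 * (\<Prod>j\<in>F - J. (1 + sgn (?u j \<bullet> z)) / 2))"
              using True F'(1) cofacet_notin[OF i] by (auto simp: f_def)
            also have "(\<Prod>j\<in>F - J. (1 + sgn (?u j \<bullet> z)) / 2) = D"
              unfolding D_def using z up by (intro prod.cong refl) simp
            also have "sgn (?u i \<bullet> z) = sgn (e \<bullet> z) * sgn (e \<bullet> lam i)"
              by (simp add: dual_vector_normal[OF bas cofacet_notin[OF i] orth e] sgn_mult sgn_divide)
            finally show "f z (insert i F) = w (insert i F) * ((1 + sgn (e \<bullet> z) * sgn (e \<bullet> lam i)) / 2) * D"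
              by simp
          qed
        qed
        then have "eventually (\<lambda>z. \<forall>i\<in>?C. f z (insert i F) = w (insert i F) * ((1 + sgn (e \<bullet> z) * sgn (e \<bullet> lam i)) / 2) * D) (nhds p)"
          by (intro eventually_ball_finite finite_cofacets ballI)
        then have "eventually (\<lambda>z. (\<Sum>i\<in>?C. f z (insert i F)) = (\<Sum>i\<in>?C. w (insert i F)) / 2 * D) (nhds p)"
        proof (rule eventually_mono)
          fix z assume "\<forall>i\<in>?C. f z (insert i F) = w (insert i F) * ((1 + sgn (e \<bullet> z) * sgn (e \<bullet> lam i)) / 2) * D"
          then have "(\<Sum>i\<in>?C. f z (insert i F)) = (\<Sum>i\<in>?C. w (insert i F) * (D / 2)
              + w (insert i F) * sgn (e \<bullet> lam i) * (sgn (e \<bullet> z) * D / 2))"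
            by (intro sum.cong refl) (auto simp: field_simps)
          also have "\<dots> = (\<Sum>i\<in>?C. w (insert i F)) * (D / 2)
              + (\<Sum>i\<in>?C. w (insert i F) * sgn (e \<bullet> lam i)) * (sgn (e \<bullet> z) * D / 2)"
            by (simp only: sum.distrib sum_distrib_right)
          also have "(\<Sum>i\<in>?C. w (insert i F) * sgn (e \<bullet> lam i)) = 0"
            using bal e F by (simp add: wall_balanced_def)
          finally show "(\<Sum>i\<in>?C. f z (insert i F)) = (\<Sum>i\<in>?C. w (insert i F)) / 2 * D" by simp
        qed
        then show ?thesis by blast
      qed
    qed
    \<comment> \<open>Neighbourhoods of \<open>p\<close> contain \<open>p\<close>, so the constant
      is the value there.\<close>
    have wall': "eventually (\<lambda>z. (\<Sum>i\<in>cofacets m w F. f z (insert i F)) = (\<Sum>i\<in>cofacets m w F. f p (insert i F))) (nhds p)"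
      if F: "F \<in> walls m lam e" for F
    proof -
      obtain C where C: "eventually (\<lambda>z. (\<Sum>i\<in>cofacets m w F. f z (insert i F)) = C) (nhds p)"
        using wall[OF F] by blast
      from eventually_nhds_x_imp_x[OF C] C show ?thesis by simp
    qed
    have "eventually (\<lambda>z. (\<forall>I\<in>?R. f z I = f p I) \<and> (\<forall>F\<in>walls m lam e.
        (\<Sum>i\<in>cofacets m w F. f z (insert i F)) = (\<Sum>i\<in>cofacets m w F. f p (insert i F)))) (nhds p)"
      by (intro eventually_conj eventually_ball_finite ballI away wall' finite_walls)
        (auto simp: finite_max_simplices)
    then show ?thesis
      by (rule eventually_mono)
        (unfold sm sum_by_walls[OF fan e], auto intro!: arg_cong2[of _ _ _ _ "(+)"] sum.cong)
  qed
qed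

text \<open>The segment from \<open>x\<close> ends at a perturbation \<open>q\<close> of
  \<open>y\<close> with the same multiplicity, chosen so that no point of the segment lies on two
  different wall hyperplanes.\<close>

lemma smoothed_multiplicity_constant:
  fixes lam :: "nat \<Rightarrow> 'a::euclidean_space"
  assumes fan: "multifan m w lam" and bal: "wall_balanced m w lam"
    and x: "\<And>e. e \<in> normals m w lam J \<Longrightarrow> e \<bullet> x \<noteq> 0"
    and y: "\<And>e. e \<in> normals m w lam J \<Longrightarrow> e \<bullet> y \<noteq> 0"
  shows "smoothed_multiplicity m w lam J x = smoothed_multiplicity m w lam J y"
proof -
  let ?N = "normals m w lam J" and ?d = "smoothed_multiplicity m w lam J"
  \<comment> \<open>Each such combination vanishes at \<open>x\<close> and wherever \<open>e\<close>
    and \<open>u\<close> both vanish. If the segment met both hyperplanes at a point other than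
    \<open>x\<close>, the combination would vanish at \<open>q\<close> too. It is zero only if
    \<open>e\<close> and \<open>u\<close> are parallel.\<close>
  define Z where "Z = (\<lambda>(e, u). (e \<bullet> x) *\<^sub>R u - (u \<bullet> x) *\<^sub>R e) ` (?N \<times> ?N) - {0}"
  have "finite Z" by (simp add: Z_def finite_normals)
  then obtain z where z: "\<forall>c\<in>Z. c \<bullet> z \<noteq> 0"
    using exists_generic_direction[of Z] by (auto simp: Z_def)
  have "((\<lambda>s. y + s *\<^sub>R z) \<longlongrightarrow> y + 0 *\<^sub>R z) (at_right (0::real))"
    by (intro tendsto_intros)
  then have "filterlim (\<lambda>s. y + s *\<^sub>R z) (nhds y) (at_right (0::real))" by simp
  moreover have "eventually (\<lambda>q. ?d q = ?d y) (nhds y)"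
    using y by (intro smoothed_multiplicity_locally_constant[OF fan bal]) blast
  ultimately have "eventually (\<lambda>s. ?d (y + s *\<^sub>R z) = ?d y) (at_right (0::real))"
    by (rule eventually_compose_filterlim[rotated])
  moreover have "eventually (\<lambda>s. \<forall>c\<in>Z. c \<bullet> (y + s *\<^sub>R z) \<noteq> 0) (at_right (0::real))"
    using z \<open>finite Z\<close> by (intro eventually_ball_finite ballI eventually_inner_nonzero) auto
  ultimately have "eventually (\<lambda>s. ?d (y + s *\<^sub>R z) = ?d y \<and> (\<forall>c\<in>Z. c \<bullet> (y + s *\<^sub>R z) \<noteq> 0)) (at_right (0::real))"
    by (rule eventually_conj)
  from eventually_happens'[OF _ this] obtain q where q: "?d q = ?d y" "\<forall>c\<in>Z. c \<bullet> q \<noteq> 0"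
    by (auto simp: trivial_limit_at_right_real)
  have "eventually (\<lambda>b. ?d p = ?d b) (at p within closed_segment x q)" if "p \<in> closed_segment x q" for p
  proof -
    obtain t where t: "p = (1 - t) *\<^sub>R x + t *\<^sub>R q" using \<open>p \<in> closed_segment x q\<close> by (auto simp: in_segment)
    have "eventually (\<lambda>b. ?d b = ?d p) (nhds p)"
    proof (rule smoothed_multiplicity_locally_constant[OF fan bal])
      fix e u assume eu: "e \<in> ?N" "u \<in> ?N" "e \<bullet> p = 0" "u \<bullet> p = 0"
      let ?c = "(e \<bullet> x) *\<^sub>R u - (u \<bullet> x) *\<^sub>R e"
      show "\<exists>c. u = c *\<^sub>R e"
      proof (cases "?c = 0")
        case True
        then have "(e \<bullet> x) *\<^sub>R u = (u \<bullet> x) *\<^sub>R e" by simp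
        then have "(1 / (e \<bullet> x)) *\<^sub>R (e \<bullet> x) *\<^sub>R u = (1 / (e \<bullet> x)) *\<^sub>R (u \<bullet> x) *\<^sub>R e" by simp
        then show ?thesis using x[OF eu(1)] by auto
      next
        case False
        then have "?c \<in> Z" unfolding Z_def using eu by auto
        then have cq: "?c \<bullet> q \<noteq> 0" using q(2) by blast
        have "?c \<bullet> p = 0" using eu by (simp add: inner_diff_left)
        moreover have "?c \<bullet> x = 0" by (simp add: inner_diff_left)
        ultimately have "t * (?c \<bullet> q) = 0" unfolding t by (simp only: inner_add_right inner_scaleR_right)
        then have "t = 0" using cq by simp
        \<comment> \<open>The point would be \<open>x\<close> itself, where no normal
          vanishes.\<close>
        then show ?thesis using x[OF eu(1)] eu(3) t by simp
      qed
    qed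
    then show ?thesis
      by (auto simp: eventually_at_filter elim: eventually_mono)
  qed
  then have "?d x = ?d q"
    by (intro connected_local_const[of "closed_segment x q"]) auto
  then show ?thesis using q(1) by simp
qed

text \<open>Off the wall hyperplanes each factor \<open>(1 + sgn ...) / 2\<close> is the indicator
  of a half-space, and their product is the indicator of the cone. Maximal simplices of the
  projection are the \<open>I - J\<close> with \<open>J \<subseteq> I\<close>.\<close>

lemma multiplicity_eq_smoothed:
  fixes lam :: "nat \<Rightarrow> 'a::euclidean_space"
  assumes fan: "multifan m w lam" and J: "J \<in> faces {1..m} DIM('a) w"
    and x: "\<And>e. e \<in> normals m w lam J \<Longrightarrow> e \<bullet> x \<noteq> 0"
  shows "multiplicity_at ({1..m} - J) (DIM('a) - card J) (\<lambda>J'. w (J \<union> J')) (span (lam ` J)) lam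
      (coset (span (lam ` J)) x) = smoothed_multiplicity m w lam J x"
proof -
  let ?M = "max_simplices {1..m} DIM('a) w"
  let ?M' = "max_simplices ({1..m} - J) (DIM('a) - card J) (\<lambda>J'. w (J \<union> J'))"
  let ?U = "span (lam ` J)"
  obtain K where "J \<subseteq> K" "K \<in> ?M" using J by (auto simp: faces_def)
  then have J': "finite J" "J \<subseteq> {1..m}"
    by (auto simp: max_simplices_def intro: finite_subset)
  have "finite K" "card K = DIM('a)" using \<open>K \<in> ?M\<close> by (auto simp: max_simplices_def intro: finite_subset)
  \<comment> \<open>The dimension of the projection is a truncated difference; this bound makes
    cardinalities add up again.\<close>
  then have J'': "card J \<le> DIM('a)" using card_mono[OF _ \<open>J \<subseteq> K\<close>] by simp
  have bij: "bij_betw (\<lambda>I. I - J) {I \<in> ?M. J \<subseteq> I} ?M'"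
  proof (rule bij_betw_byWitness[where f' = "\<lambda>I. J \<union> I"])
    show "\<forall>I\<in>{I \<in> ?M. J \<subseteq> I}. J \<union> (I - J) = I" by auto
    show "\<forall>I\<in>?M'. J \<union> I - J = I" by (auto simp: max_simplices_def)
    show "(\<lambda>I. I - J) ` {I \<in> ?M. J \<subseteq> I} \<subseteq> ?M'"
      using J' by (auto simp: max_simplices_def card_Diff_subset Un_absorb1)
    show "(\<lambda>I. J \<union> I) ` ?M' \<subseteq> {I \<in> ?M. J \<subseteq> I}"
    proof
      fix L assume "L \<in> (\<lambda>I. J \<union> I) ` ?M'"
      then obtain I where L: "L = J \<union> I" and I: "I \<in> ?M'" by blast
      then have "card (J \<union> I) = card J + card I"
        using J' by (intro card_Un_disjoint) (auto simp: max_simplices_def intro: finite_subset)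
      then show "L \<in> {I \<in> ?M. J \<subseteq> I}" using I J' J'' by (auto simp: L max_simplices_def)
    qed
  qed
  have "multiplicity_at ({1..m} - J) (DIM('a) - card J) (\<lambda>J'. w (J \<union> J')) ?U lam (coset ?U x)
      = (\<Sum>I'\<in>?M'. if coset ?U x \<in> quotient_cone ?U lam I' then w (J \<union> I') else 0)"
    unfolding multiplicity_at_def by (rule sum.inter_filter) (simp add: finite_max_simplices)
  also have "\<dots> = (\<Sum>I\<in>{I \<in> ?M. J \<subseteq> I}. if coset ?U x \<in> quotient_cone ?U lam (I - J) then w (J \<union> (I - J)) else 0)"
    by (rule sum.reindex_bij_betw[OF bij, symmetric])
  also have "\<dots> = (\<Sum>I\<in>{I \<in> ?M. J \<subseteq> I}. w I * (\<Prod>i\<in>I - J. (1 + sgn (dual_vector lam I i \<bullet> x)) / 2))"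
  proof (rule sum.cong[OF refl])
    fix I assume "I \<in> {I \<in> ?M. J \<subseteq> I}"
    then have I: "I \<in> ?M" "J \<subseteq> I" by auto
    have bas: "is_basis lam I" by (rule multifan_is_basis[OF fan I(1)])
    have fin: "finite (I - J)" using is_basis_finite[OF bas] by simp
    have half: "(1 + sgn (dual_vector lam I i \<bullet> x)) / 2 = (if 0 \<le> dual_vector lam I i \<bullet> x then 1 else 0)"
      if "i \<in> I - J" for i
    proof -
      have "dual_vector lam I i \<bullet> x \<noteq> 0" using that I x unfolding normals_def by blast
      then show ?thesis by (auto simp: sgn_if)
    qed
    have "(\<Prod>i\<in>I - J. (1 + sgn (dual_vector lam I i \<bullet> x)) / 2)
        = (\<Prod>i\<in>I - J. if 0 \<le> dual_vector lam I i \<bullet> x then 1 else 0)"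
      by (intro prod.cong refl half)
    also have "\<dots> = (if \<forall>i\<in>I - J. 0 \<le> dual_vector lam I i \<bullet> x then 1 else 0)"
      using fin by (auto intro: prod.neutral prod_zero)
    finally show "(if coset ?U x \<in> quotient_cone ?U lam (I - J) then w (J \<union> (I - J)) else 0)
        = w I * (\<Prod>i\<in>I - J. (1 + sgn (dual_vector lam I i \<bullet> x)) / 2)"
      using quotient_cone_iff[OF bas I(2), of x] I(2) by (simp add: Un_absorb1)
  qed
  also have "\<dots> = smoothed_multiplicity m w lam J x"
    unfolding smoothed_multiplicity_def by (rule sum.inter_filter) (simp add: finite_max_simplices)
  finally show ?thesis .
qed

text \<open>If \<open>e\<close> vanished at \<open>x\<close>, the class of \<open>x\<close> would
  lie in the span of the facet of \<open>I - J\<close> opposite to \<open>i\<close>, a face with too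
  few vertices for a generic point.\<close>

lemma generic_normals:
  fixes lam :: "nat \<Rightarrow> 'a::euclidean_space"
  assumes fan: "multifan m w lam"
    and gen: "generic ({1..m} - J) (DIM('a) - card J) (\<lambda>J'. w (J \<union> J')) (span (lam ` J)) lam (coset (span (lam ` J)) x)"
    and e: "e \<in> normals m w lam J"
  shows "e \<bullet> x \<noteq> 0"
proof
  assume "e \<bullet> x = 0"
  obtain I i where I: "I \<in> max_simplices {1..m} DIM('a) w" "J \<subseteq> I" "i \<in> I - J" "e = dual_vector lam I i"
    using e unfolding normals_def by blast
  have bas: "is_basis lam I" by (rule multifan_is_basis[OF fan I(1)])
  have fin: "finite I" "finite J" using is_basis_finite[OF bas] I(2) finite_subset by auto
  have card: "card (I - J) = DIM('a) - card J"
    using fin I by (simp add: card_Diff_subset max_simplices_def)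
  have "I - J \<in> max_simplices ({1..m} - J) (DIM('a) - card J) (\<lambda>J'. w (J \<union> J'))"
    using I card by (auto simp: max_simplices_def Un_absorb1)
  then have "I - J - {i} \<in> faces ({1..m} - J) (DIM('a) - card J) (\<lambda>J'. w (J \<union> J'))"
    unfolding faces_def by blast
  moreover have "card (I - J - {i}) < DIM('a) - card J"
    using I(3) fin card by (metis card_Diff1_less finite_Diff)
  ultimately have "coset (span (lam ` J)) x \<notin> quotient_span (span (lam ` J)) lam (I - J - {i})"
    using gen unfolding generic_def by blast
  then show False using quotient_span_mem[OF bas I(2,3), of x] I(4) \<open>e \<bullet> x = 0\<close> by simp
qed

lemma wall_balanced_imp_complete:
  fixes lam :: "nat \<Rightarrow> 'a::euclidean_space"
  assumes fan: "multifan m w lam" and bal: "wall_balanced m w lam"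
  shows "complete_multifan m w lam"
  unfolding complete_multifan_def pre_complete_def
proof (intro ballI allI impI)
  fix J a b
  assume J: "J \<in> faces {1..m} DIM('a) w"
  let ?g = "generic ({1..m} - J) (DIM('a) - card J) (\<lambda>J'. w (J \<union> J')) (span (lam ` J)) lam"
  assume ab: "?g a" "?g b"
  obtain x y where xy: "a = coset (span (lam ` J)) x" "b = coset (span (lam ` J)) y"
    using ab unfolding generic_def by blast
  have x: "e \<bullet> x \<noteq> 0" and y: "e \<bullet> y \<noteq> 0" if "e \<in> normals m w lam J" for e
    using generic_normals[OF fan _ that] ab unfolding xy by blast+
  let ?mult = "multiplicity_at ({1..m} - J) (DIM('a) - card J) (\<lambda>J'. w (J \<union> J')) (span (lam ` J)) lam"
  have "?mult a = smoothed_multiplicity m w lam J x"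
    unfolding xy by (rule multiplicity_eq_smoothed[OF fan J]) (rule x)
  also have "\<dots> = smoothed_multiplicity m w lam J y"
    by (rule smoothed_multiplicity_constant[OF fan bal]) (fact x y)+
  also have "\<dots> = ?mult b"
    unfolding xy by (rule multiplicity_eq_smoothed[OF fan J, symmetric]) (rule y)
  finally show "?mult a = ?mult b" .
qed

theorem theorem4p1:
  fixes orientation :: "'a::euclidean_space list"
    and m :: nat
    and w :: "nat set \<Rightarrow> real"
    and lam :: "nat \<Rightarrow> 'a"
  assumes "ordered_basis orientation"
    and "multifan m w lam"
  shows "(index_map m w lam ` poly_ring m \<subseteq> range in_symalg
            \<longleftrightarrow> closed_chain (underlying_chain orientation m w lam))
         \<and> (closed_chain (underlying_chain orientation m w lam) \<longleftrightarrow> complete_multifan m w lam)"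
  using closed_chain_iff_wall_balanced[OF assms] wall_balanced_imp_index_map[OF assms(2)]
    index_map_imp_wall_balanced[OF assms(2)] complete_imp_wall_balanced[OF assms(2)]
    wall_balanced_imp_complete[OF assms(2)]
  by blast

end
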